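(* Let $G$ be a discrete group which is an RD-group for a length-function $L$, and let $\beta$ be a length-preserving automorphism of $G$ (i.e. $L(\beta(g))=L(g)$ for all $g\in G$) such that each orbit of $\beta$ in $G$ is either infinite or a singleton. Let $\alpha$ be the automorphism of the reduced group $C^*$-algebra $C^*_r(G)$ induced by $\beta$, i.e. $\alpha(\lambda_g)=\lambda_{\beta(g)}$, $g\in G$. Then $\alpha$ is $E$-mixing, where $E$ is the conditional expectation of $C^*_r(G)$ onto the fixed-point subalgebra of $\alpha$: for every $x\in C^*_r(G)$ and every state $\varphi$ of $C^*_r(G)$, $$\lim_{n\to+\infty}\varphi(\alpha^n(x))=\varphi(E(x)).$$
   Context: $\lambda$ is the left regular representation of $G$ on $\ell^2(G)$ and $C^*_r(G)$ is the $C^*$-algebra generated by $\{\lambda_g: g\in G\}$. A length-function on $G$ is a map $L:G\to[0,+\infty)$ with $L(e)=0$, $L(g^{-1})=L(g)$, $L(gh)\le L(g)+L(h)$. $G$ is an RD-group for $L$ (has rapid decay) if there are constants $C,s>0$ such that for every finitely supported $f:G\to\mathbb C$, $$\Big\|\sum_{g}f(g)\lambda_g\Big\|\le C\Big(\sum_g|f(g)|^2(1+L(g))^{2s}\Big)^{1/2}.$$ A conditional expectation is a norm-one projection of a $C^*$-algebra onto a $C^*$-subalgebra. Here the fixed-point subalgebra is $C^*_r(H)\subset C^*_r(G)$, with $H=\{g\in G:\beta(g)=g\}$, and $E$ is the conditional expectation onto it given by the pointwise norm limit $E(x)=\lim_{n\to+\infty}\frac1n\sum_{k=1}^n\alpha^k(x)$,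 $x\in C^*_r(G)$ (this limit exists); equivalently $E(\lambda_g)=\lambda_g$ for $g\in H$ and $E(\lambda_g)=0$ for $g\notin H$. *)

theory Defs
  imports "HOL-Analysis.Analysis"
begin

text \<open>A discrete group is a type of class \<open>group_add\<close>. This class does not assume
  commutativity, so \<open>g + h\<close>, \<open>- g\<close>, \<open>0\<close> stand for \<open>gh\<close>, \<open>g\<^sup>-\<^sup>1\<close>, \<open>e\<close>.\<close>

typedef 'a ell2 = "{f :: 'a \<Rightarrow> complex. (\<lambda>a. (cmod (f a))\<^sup>2) summable_on UNIV}"
  morphisms ell2_apply Abs_ell2
  by (rule exI[of _ "\<lambda>_. 0"]) simp

setup_lifting type_definition_ell2

lemma summable_sq_add:
  fixes f g :: "'a \<Rightarrow> complex"
  assumes "(\<lambda>a. (cmod (f a))\<^sup>2) summable_on UNIV" "(\<lambda>a. (cmod (g a))\<^sup>2) summable_on UNIV"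
  shows "(\<lambda>a. (cmod (f a + g a))\<^sup>2) summable_on UNIV"
proof (rule summable_on_comparison_test)
  show "(\<lambda>a. 2 * (cmod (f a))\<^sup>2 + 2 * (cmod (g a))\<^sup>2) summable_on UNIV"
    by (intro summable_on_add summable_on_cmult_right assms)
  fix a
  have "(cmod (f a + g a))\<^sup>2 \<le> (cmod (f a) + cmod (g a))\<^sup>2"
    by (intro power_mono norm_triangle_ineq) auto
  also have "\<dots> \<le> 2 * (cmod (f a))\<^sup>2 + 2 * (cmod (g a))\<^sup>2"
    using sum_squares_bound[of "cmod (f a)" "cmod (g a)"] by (simp add: power2_sum)
  finally show "(cmod (f a + g a))\<^sup>2 \<le> 2 * (cmod (f a))\<^sup>2 + 2 * (cmod (g a))\<^sup>2" .
qed auto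

lemma summable_sq_cmult:
  fixes f :: "'a \<Rightarrow> complex"
  assumes "(\<lambda>a. (cmod (f a))\<^sup>2) summable_on UNIV"
  shows "(\<lambda>a. (cmod (c * f a))\<^sup>2) summable_on UNIV"
  using summable_on_cmult_right[OF assms, of "(cmod c)\<^sup>2"]
  by (simp add: norm_mult power_mult_distrib)

lemma summable_inner:
  fixes f g :: "'a \<Rightarrow> complex"
  assumes "(\<lambda>a. (cmod (f a))\<^sup>2) summable_on UNIV" "(\<lambda>a. (cmod (g a))\<^sup>2) summable_on UNIV"
  shows "(\<lambda>a. f a \<bullet> g a) summable_on UNIV"
proof -
  have "(\<lambda>a. ((cmod (f a + g a))\<^sup>2 + (- 1) * (cmod (f a))\<^sup>2 + (- 1) * (cmod (g a))\<^sup>2) * (1/2))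
      summable_on UNIV"
    by (intro summable_on_add summable_on_cmult_right summable_on_cmult_left summable_sq_add assms)
  then show ?thesis
    by (simp add: dot_norm)
qed

instantiation ell2 :: (type) real_inner
begin

lift_definition zero_ell2 :: "'a ell2" is "\<lambda>_. 0" by simp
lift_definition plus_ell2 :: "'a ell2 \<Rightarrow> 'a ell2 \<Rightarrow> 'a ell2" is "\<lambda>f g a. f a + g a"
  by (rule summable_sq_add)
lift_definition uminus_ell2 :: "'a ell2 \<Rightarrow> 'a ell2" is "\<lambda>f a. - f a" by simp
lift_definition minus_ell2 :: "'a ell2 \<Rightarrow> 'a ell2 \<Rightarrow> 'a ell2" is "\<lambda>f g a. f a - g a"
  using summable_sq_add[of _ "\<lambda>a. - _ a"] by simp
lift_definition scaleR_ell2 :: "real \<Rightarrow> 'a ell2 \<Rightarrow> 'a ell2" is "\<lambda>r f a. complex_of_real r * f a"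
  by (rule summable_sq_cmult)
lift_definition inner_ell2 :: "'a ell2 \<Rightarrow> 'a ell2 \<Rightarrow> real" is "\<lambda>f g. \<Sum>\<^sub>\<infinity>a. f a \<bullet> g a" .
lift_definition norm_ell2 :: "'a ell2 \<Rightarrow> real" is "\<lambda>f. sqrt (\<Sum>\<^sub>\<infinity>a. (cmod (f a))\<^sup>2)" .

definition "sgn_ell2 (f :: 'a ell2) = inverse (norm f) *\<^sub>R f"
definition "dist_ell2 (f :: 'a ell2) g = norm (f - g)"
definition "(uniformity :: ('a ell2 \<times> 'a ell2) filter) =
  (INF e\<in>{0 <..}. principal {(f, g). dist f g < e})"
definition "open (U :: 'a ell2 set) =
  (\<forall>f\<in>U. eventually (\<lambda>(f', g). f' = f \<longrightarrow> g \<in> U) uniformity)"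

instance
proof
  fix f g h :: "'a ell2" and r s :: real
  show "f + g + h = f + (g + h)" by transfer (simp add: add.assoc)
  show "f + g = g + f" by transfer (simp add: add.commute)
  show "0 + f = f" by transfer simp
  show "- f + f = 0" by transfer simp
  show "f - g = f + - g" by transfer simp
  show "r *\<^sub>R (f + g) = r *\<^sub>R f + r *\<^sub>R g" by transfer (simp add: algebra_simps)
  show "(r + s) *\<^sub>R f = r *\<^sub>R f + s *\<^sub>R f" by transfer (simp add: algebra_simps)
  show "r *\<^sub>R s *\<^sub>R f = (r * s) *\<^sub>R f" by transfer (simp add: algebra_simps)
  show "1 *\<^sub>R f = f" by transfer simp
  show "sgn f = inverse (norm f) *\<^sub>R f" by (fact sgn_ell2_def)
  show "dist f g = norm (f - g)" by (fact dist_ell2_def)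
  show "(uniformity :: ('a ell2 \<times> 'a ell2) filter) =
      (INF e\<in>{0 <..}. principal {(f, g). dist f g < e})" by (fact uniformity_ell2_def)
  show "open U = (\<forall>f\<in>U. \<forall>\<^sub>F (f', g) in uniformity. f' = f \<longrightarrow> g \<in> U)" for U :: "'a ell2 set"
    by (fact open_ell2_def)
  show "f \<bullet> g = g \<bullet> f" by transfer (simp add: inner_commute)
  show "(f + g) \<bullet> h = f \<bullet> h + g \<bullet> h"
    by transfer (simp add: inner_add_left infsum_add summable_inner)
  show "(r *\<^sub>R f) \<bullet> g = r * (f \<bullet> g)"
    by transfer (simp flip: scaleR_conv_of_real add: infsum_cmult_right')
  show "0 \<le> f \<bullet> f" by transfer (simp add: infsum_nonneg)
  show "f \<bullet> f = 0 \<longleftrightarrow> f = 0"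
  proof (transfer, safe)
    fix f :: "'a \<Rightarrow> complex"
    assume summ: "(\<lambda>a. (cmod (f a))\<^sup>2) summable_on UNIV" and zero: "(\<Sum>\<^sub>\<infinity>a. f a \<bullet> f a) = 0"
    have "(cmod (f a))\<^sup>2 = 0" for a
      using nonneg_infsum_le_0D[of "\<lambda>a. (cmod (f a))\<^sup>2" UNIV a] summ zero
      by (simp add: dot_square_norm)
    then show "f = (\<lambda>_. 0)" by auto
  qed simp
  show "norm f = sqrt (f \<bullet> f)" by transfer (simp add: dot_square_norm)
qed

end

lift_definition cinner :: "'a ell2 \<Rightarrow> 'a ell2 \<Rightarrow> complex"
  is "\<lambda>f g. \<Sum>\<^sub>\<infinity>a. cnj (f a) * g a" .

text \<open>The library's bounded operators are real-linear; complex linearity is imposed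
  separately, in \<open>cstar_algebra\<close> below. The operator norm does not depend on the scalar field.\<close>

type_synonym 'a operator = "'a ell2 \<Rightarrow>\<^sub>L 'a ell2"

lift_definition scale_ell2 :: "complex \<Rightarrow> 'a ell2 \<Rightarrow> 'a ell2" is "\<lambda>c f a. c * f a"
  by (rule summable_sq_cmult)

lemma norm_scale_ell2: "norm (scale_ell2 c f) = cmod c * norm f"
  by transfer (simp add: norm_mult power_mult_distrib infsum_cmult_right' real_sqrt_mult)

lift_definition scalar_op :: "complex \<Rightarrow> 'a operator" is scale_ell2
proof (rule bounded_linear_intro)
  fix c :: complex and f g :: "'a ell2" and r :: real
  show "scale_ell2 c (f + g) = scale_ell2 c f + scale_ell2 c g"
    by transfer (simp add: algebra_simps)
  show "scale_ell2 c (r *\<^sub>R f) = r *\<^sub>R scale_ell2 c f"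
    by transfer (simp add: algebra_simps)
  show "norm (scale_ell2 c f) \<le> norm f * cmod c"
    by (simp add: norm_scale_ell2)
qed

definition scale_op :: "complex \<Rightarrow> 'a operator \<Rightarrow> 'a operator" where
  "scale_op c x = scalar_op c o\<^sub>L x"

text \<open>The Hilbert space adjoint. It exists and is unique for every complex-linear bounded operator;
  on operators that are not complex-linear the value is irrelevant.\<close>

definition adj :: "'a operator \<Rightarrow> 'a operator" where
  "adj x = (THE y. \<forall>\<xi> \<eta>. cinner (blinfun_apply x \<xi>) \<eta> = cinner \<xi> (blinfun_apply y \<eta>))"

definition clinear_op :: "'a operator \<Rightarrow> bool" where
  "clinear_op x \<longleftrightarrow>
    (\<forall>c \<xi>. blinfun_apply x (scale_ell2 c \<xi>) = scale_ell2 c (blinfun_apply x \<xi>))"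

definition cstar_algebra :: "'a operator set \<Rightarrow> bool" where
  "cstar_algebra A \<longleftrightarrow>
    (\<forall>x\<in>A. clinear_op x) \<and> 0 \<in> A \<and>
    (\<forall>x\<in>A. \<forall>y\<in>A. x + y \<in> A) \<and> (\<forall>c. \<forall>x\<in>A. scale_op c x \<in> A) \<and>
    (\<forall>x\<in>A. \<forall>y\<in>A. x o\<^sub>L y \<in> A) \<and> (\<forall>x\<in>A. adj x \<in> A) \<and> closed A"

definition clinear_on :: "'a operator set \<Rightarrow> (complex \<Rightarrow> 'b \<Rightarrow> 'b) \<Rightarrow> ('a operator \<Rightarrow> 'b::ab_group_add) \<Rightarrow> bool"
  where "clinear_on A s f \<longleftrightarrow>
    (\<forall>x\<in>A. \<forall>y\<in>A. f (x + y) = f x + f y) \<and> (\<forall>c. \<forall>x\<in>A. f (scale_op c x) = s c (f x))"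

text \<open>The norm of \<open>f\<close> as a map on \<open>A\<close> only. The bound is needed because \<open>Sup\<close> on \<open>real\<close> is
  unspecified for unbounded sets.\<close>

definition norm_one_on :: "'a operator set \<Rightarrow> ('a operator \<Rightarrow> 'b::real_normed_vector) \<Rightarrow> bool" where
  "norm_one_on A f \<longleftrightarrow>
    bdd_above ((\<lambda>x. norm (f x)) ` {x \<in> A. norm x \<le> 1}) \<and>
    (SUP x\<in>{x \<in> A. norm x \<le> 1}. norm (f x)) = 1"

definition star_automorphism :: "'a operator set \<Rightarrow> ('a operator \<Rightarrow> 'a operator) \<Rightarrow> bool" where
  "star_automorphism A \<alpha> \<longleftrightarrow>
    bij_betw \<alpha> A A \<and> clinear_on A scale_op \<alpha> \<and>
    (\<forall>x\<in>A. \<forall>y\<in>A. \<alpha> (x o\<^sub>L y) = \<alpha> x o\<^sub>L \<alpha> y) \<and> (\<forall>x\<in>A. \<alpha> (adj x) = adj (\<alpha> x))"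

definition state :: "'a operator set \<Rightarrow> ('a operator \<Rightarrow> complex) \<Rightarrow> bool" where
  "state A \<phi> \<longleftrightarrow>
    clinear_on A (*) \<phi> \<and> (\<forall>x\<in>A. \<phi> (adj x o\<^sub>L x) \<in> \<real>\<^sub>\<ge>\<^sub>0) \<and> norm_one_on A \<phi>"

definition conditional_expectation ::
    "'a operator set \<Rightarrow> 'a operator set \<Rightarrow> ('a operator \<Rightarrow> 'a operator) \<Rightarrow> bool" where
  "conditional_expectation A B E \<longleftrightarrow>
    cstar_algebra A \<and> cstar_algebra B \<and> B \<subseteq> A \<and>
    clinear_on A scale_op E \<and> E ` A \<subseteq> B \<and> (\<forall>x\<in>B. E x = x) \<and> norm_one_on A E"

definition fixed_subalgebra :: "'a operator set \<Rightarrow> ('a operator \<Rightarrow> 'a operator) \<Rightarrow> 'a operator set" where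
  "fixed_subalgebra A \<alpha> = {x \<in> A. \<alpha> x = x}"

definition ergodic_average :: "('a operator \<Rightarrow> 'a operator) \<Rightarrow> nat \<Rightarrow> 'a operator \<Rightarrow> 'a operator" where
  "ergodic_average \<alpha> n x = (1 / real n) *\<^sub>R (\<Sum>k=1..n. (\<alpha> ^^ k) x)"

text \<open>A norm limit. Since \<open>lim\<close> is unspecified for divergent sequences, convergence has to be
  asserted wherever this is used.\<close>

definition ergodic_limit :: "('a operator \<Rightarrow> 'a operator) \<Rightarrow> 'a operator \<Rightarrow> 'a operator" where
  "ergodic_limit \<alpha> x = lim (\<lambda>n. ergodic_average \<alpha> n x)"

definition mixing_wrt ::
    "'a operator set \<Rightarrow> ('a operator \<Rightarrow> 'a operator) \<Rightarrow> ('a operator \<Rightarrow> 'a operator) \<Rightarrow> bool" where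
  "mixing_wrt A E \<alpha> \<longleftrightarrow>
    (\<forall>x\<in>A. \<forall>\<phi>. state A \<phi> \<longrightarrow> (\<lambda>n. \<phi> ((\<alpha> ^^ n) x)) \<longlonglongrightarrow> \<phi> (E x))"

lemma bij_left_translation: "bij (\<lambda>h. - g + h :: 'g::group_add)"
  by (rule bij_betw_byWitness[where f' = "\<lambda>h. g + h"]) (auto simp: add.assoc[symmetric])

lift_definition translate :: "'g::group_add \<Rightarrow> 'g ell2 \<Rightarrow> 'g ell2" is "\<lambda>g f h. f (- g + h)"
proof -
  fix g :: 'g and f :: "'g \<Rightarrow> complex"
  assume "(\<lambda>a. (cmod (f a))\<^sup>2) summable_on UNIV"
  then show "(\<lambda>h. (cmod (f (- g + h)))\<^sup>2) summable_on UNIV"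
    using summable_on_reindex_bij_betw[OF bij_left_translation[of g], of "\<lambda>a. (cmod (f a))\<^sup>2"]
    by simp
qed

lemma norm_translate: "norm (translate g f) = norm f"
proof (transfer, goal_cases)
  case (1 g f)
  show ?case
    using infsum_reindex_bij_betw[OF bij_left_translation[of g], of "\<lambda>a. (cmod (f a))\<^sup>2"] by simp
qed

lift_definition left_regular :: "'g::group_add \<Rightarrow> 'g operator" is translate
proof (rule bounded_linear_intro)
  fix g :: 'g and f f' :: "'g ell2" and r :: real
  show "translate g (f + f') = translate g f + translate g f'" by transfer simp
  show "translate g (r *\<^sub>R f) = r *\<^sub>R translate g f" by transfer simp
  show "norm (translate g f) \<le> norm f * 1" by (simp add: norm_translate)
qed

definition reduced_cstar_algebra :: "'g::group_add operator set" where
  "reduced_cstar_algebra = cstar_algebra hull range left_regular"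

definition length_function :: "('g::group_add \<Rightarrow> real) \<Rightarrow> bool" where
  "length_function L \<longleftrightarrow>
    (\<forall>g. 0 \<le> L g) \<and> L 0 = 0 \<and> (\<forall>g. L (- g) = L g) \<and> (\<forall>g h. L (g + h) \<le> L g + L h)"

definition rapid_decay :: "('g::group_add \<Rightarrow> real) \<Rightarrow> bool" where
  "rapid_decay L \<longleftrightarrow>
    (\<exists>C>0. \<exists>s>0. \<forall>f :: 'g \<Rightarrow> complex. finite {g. f g \<noteq> 0} \<longrightarrow>
      norm (\<Sum>g | f g \<noteq> 0. scale_op (f g) (left_regular g))
        \<le> C * sqrt (\<Sum>g | f g \<noteq> 0. (cmod (f g))\<^sup>2 * (1 + L g) powr (2 * s)))"

definition group_automorphism :: "('g::group_add \<Rightarrow> 'g) \<Rightarrow> bool" where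
  "group_automorphism \<beta> \<longleftrightarrow> bij \<beta> \<and> (\<forall>g h. \<beta> (g + h) = \<beta> g + \<beta> h)"

definition aut_orbit :: "('g \<Rightarrow> 'g) \<Rightarrow> 'g \<Rightarrow> 'g set" where
  "aut_orbit \<beta> g = range (\<lambda>n::nat. (\<beta> ^^ n) g) \<union> range (\<lambda>n::nat. (inv \<beta> ^^ n) g)"

end

(* If the orbit of g is infinite, the group elements b^n g are distinct and have equal length, so
   rapid decay bounds the norm of any combination of their unitaries by a constant times the l^2 norm
   of the coefficients. Hence the averages of alpha^k(lambda_g) tend to 0 like n^(-1/2), and the
   sequence phi(alpha^n(lambda_g)) is square summable for every bounded functional phi. Both limits
   extend from the lambda_g to the whole algebra because alpha is contractive, and they are trivial
   when b fixes g. That alpha is contractive follows from its algebraic properties: if the norm of x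
   is below 1 then 1 - x*x = w*w with w self-adjoint in the algebra, so
   1 - alpha(x)*alpha(x) = alpha(w)*alpha(w) is positive. *)
theory Submission imports Defs begin

section \<open>The Hilbert space\<close>

text \<open>The set of all x with \<phi> (\<alpha>^n x) - \<phi> (E x) tending to 0 is a closed
  subspace, but it is not visibly stable under products. Induction over the least C*-algebra
  containing the unitaries is therefore of no use until that algebra is identified with their closed
  linear span. E is given only as a limit, without a formula at a general x, so the averages are
  shown to be Cauchy instead of convergent to a known element. This step uses completeness of the
  space of operators, hence of l^2. So does the square root behind contractivity, which comes from
  Banach's fixed point theorem. Since \<open>adj\<close> is a description, working with it takes an
  existence proof for adjoints.\<close>

lemma ell2_apply_simps [simp]:
  "ell2_apply (\<xi> + \<eta>) a = ell2_apply \<xi> a + ell2_apply \<eta> a"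
  "ell2_apply (\<xi> - \<eta>) a = ell2_apply \<xi> a - ell2_apply \<eta> a"
  "ell2_apply (r *\<^sub>R \<xi>) a = complex_of_real r * ell2_apply \<xi> a"
  "ell2_apply (scale_ell2 c \<xi>) a = c * ell2_apply \<xi> a"
  "ell2_apply 0 a = 0"
  by (transfer; simp)+

lemma ell2_eqI: "(\<And>a. ell2_apply \<xi> a = ell2_apply \<eta> a) \<Longrightarrow> \<xi> = \<eta>"
  by (simp add: ell2_apply_inject[symmetric] ext)

lemma summable_ell2: "(\<lambda>a. (cmod (ell2_apply \<xi> a))\<^sup>2) summable_on UNIV"
  using ell2_apply[of \<xi>] by simp

lemma norm_ell2_sq: "(norm \<xi>)\<^sup>2 = (\<Sum>\<^sub>\<infinity>a. (cmod (ell2_apply \<xi> a))\<^sup>2)"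
  by (transfer) (simp add: infsum_nonneg)

lemma sum_le_norm_ell2_sq:
  assumes "finite F"
  shows "(\<Sum>a\<in>F. (cmod (ell2_apply \<xi> a))\<^sup>2) \<le> (norm \<xi>)\<^sup>2"
  unfolding norm_ell2_sq
  by (rule finite_sum_le_infsum[OF summable_ell2 assms]) auto

text \<open>Bounds on finite partial sums both place a function in l^2 and bound its norm. Limits of
  Cauchy sequences and values of adjoints are obtained in this way.\<close>

lemma ell2_exI:
  fixes f :: "'a \<Rightarrow> complex"
  assumes "0 \<le> C" and bound: "\<And>F. finite F \<Longrightarrow> (\<Sum>a\<in>F. (cmod (f a))\<^sup>2) \<le> C\<^sup>2"
  obtains \<xi> where "ell2_apply \<xi> = f" "norm \<xi> \<le> C"
proof -
  have summ: "(\<lambda>a. (cmod (f a))\<^sup>2) summable_on UNIV"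
    by (rule nonneg_bdd_above_summable_on) (auto intro!: bdd_aboveI[where M = "C\<^sup>2"] bound)
  then have eq: "ell2_apply (Abs_ell2 f) = f"
    by (simp add: Abs_ell2_inverse)
  have "(norm (Abs_ell2 f))\<^sup>2 \<le> C\<^sup>2"
    unfolding norm_ell2_sq eq by (rule infsum_le_finite_sums[OF summ]) (auto intro: bound)
  then have "norm (Abs_ell2 f) \<le> C"
    using \<open>0 \<le> C\<close> by (rule power2_le_imp_le)
  with eq show thesis by (rule that)
qed

lemma norm_ell2_apply_le: "cmod (ell2_apply \<xi> a) \<le> norm \<xi>"
proof (rule power2_le_imp_le)
  show "(cmod (ell2_apply \<xi> a))\<^sup>2 \<le> (norm \<xi>)\<^sup>2"
    using sum_le_norm_ell2_sq[of "{a}" \<xi>] by simp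
qed simp

text \<open>Makes the space of bounded operators complete, as needed for the fixed point argument
  and for the limits of averages. Coordinatewise limits exist because each coordinate is
  contractive; uniform bounds over finite sets of coordinates then upgrade them to norm
  limits.\<close>

instance ell2 :: (type) banach
proof
  fix X :: "nat \<Rightarrow> 'a ell2"
  assume "Cauchy X"
  have "Cauchy (\<lambda>n. ell2_apply (X n) a)" for a
  proof (rule metric_CauchyI)
    fix e :: real assume "0 < e"
    then obtain N where "\<And>m n. m \<ge> N \<Longrightarrow> n \<ge> N \<Longrightarrow> dist (X m) (X n) < e"
      using metric_CauchyD[OF \<open>Cauchy X\<close>] by blast
    then show "\<exists>N. \<forall>m\<ge>N. \<forall>n\<ge>N. dist (ell2_apply (X m) a) (ell2_apply (X n) a) < e"
      using norm_ell2_apply_le[of "X _ - X _" a]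
      by (metis dist_norm ell2_apply_simps(2) order_le_less_trans)
  qed
  then have "\<exists>l. (\<lambda>n. ell2_apply (X n) a) \<longlonglongrightarrow> l" for a
    by (simp add: Cauchy_convergent_iff convergent_def)
  then obtain f where f: "\<And>a. (\<lambda>n. ell2_apply (X n) a) \<longlonglongrightarrow> f a"
    by metis
  have tail: "\<exists>N. \<forall>n\<ge>N. \<exists>\<zeta>. ell2_apply \<zeta> = (\<lambda>a. ell2_apply (X n) a - f a) \<and> norm \<zeta> \<le> e"
    if "0 < e" for e :: real
  proof -
    obtain N where N: "\<And>m n. m \<ge> N \<Longrightarrow> n \<ge> N \<Longrightarrow> dist (X m) (X n) < e"
      using metric_CauchyD[OF \<open>Cauchy X\<close> \<open>0 < e\<close>] by blast
    have "\<exists>\<zeta>. ell2_apply \<zeta> = (\<lambda>a. ell2_apply (X n) a - f a) \<and> norm \<zeta> \<le> e" if n: "n \<ge> N" for n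
    proof -
      have "(\<Sum>a\<in>F. (cmod (ell2_apply (X n) a - f a))\<^sup>2) \<le> e\<^sup>2" if "finite F" for F
      proof (rule LIMSEQ_le_const2)
        show "(\<lambda>m. \<Sum>a\<in>F. (cmod (ell2_apply (X n) a - ell2_apply (X m) a))\<^sup>2)
          \<longlonglongrightarrow> (\<Sum>a\<in>F. (cmod (ell2_apply (X n) a - f a))\<^sup>2)"
          by (intro tendsto_intros f)
        have "(\<Sum>a\<in>F. (cmod (ell2_apply (X n) a - ell2_apply (X m) a))\<^sup>2) \<le> e\<^sup>2" if "m \<ge> N" for m
        proof -
          have "(\<Sum>a\<in>F. (cmod (ell2_apply (X n) a - ell2_apply (X m) a))\<^sup>2) \<le> (norm (X n - X m))\<^sup>2"
            using sum_le_norm_ell2_sq[OF \<open>finite F\<close>, of "X n - X m"] by simp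
          also have "\<dots> \<le> e\<^sup>2"
            using N[OF n that] by (intro power_mono) (auto simp: dist_norm)
          finally show ?thesis .
        qed
        then show "\<exists>M. \<forall>m\<ge>M. (\<Sum>a\<in>F. (cmod (ell2_apply (X n) a - ell2_apply (X m) a))\<^sup>2) \<le> e\<^sup>2"
          by blast
      qed
      then show ?thesis
        using ell2_exI[of e] \<open>0 < e\<close> by (metis less_imp_le)
    qed
    then show ?thesis by blast
  qed
  \<comment> \<open>So far f is only a coordinatewise limit. Subtracting a tail vector from
    \<open>X N\<close> gives an element of the space whose coordinates are f.\<close>
  obtain N \<zeta> where "ell2_apply \<zeta> = (\<lambda>a. ell2_apply (X N) a - f a)"
    using tail[of 1] by auto
  then have lim: "ell2_apply (X N - \<zeta>) a = f a" for a
    by simp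
  have "X \<longlonglongrightarrow> X N - \<zeta>"
  proof (rule metric_LIMSEQ_I)
    fix e :: real assume "0 < e"
    then obtain M where M: "\<And>n. n \<ge> M \<Longrightarrow>
        \<exists>\<zeta>. ell2_apply \<zeta> = (\<lambda>a. ell2_apply (X n) a - f a) \<and> norm \<zeta> \<le> e / 2"
      using tail[of "e / 2"] by auto
    have "dist (X n) (X N - \<zeta>) < e" if n: "n \<ge> M" for n
    proof -
      obtain \<zeta>' where \<zeta>': "ell2_apply \<zeta>' = (\<lambda>a. ell2_apply (X n) a - f a)" "norm \<zeta>' \<le> e / 2"
        using M[OF n] by blast
      have "X n - (X N - \<zeta>) = \<zeta>'"
        by (rule ell2_eqI) (simp only: ell2_apply_simps(2)[of "X n"] lim \<zeta>'(1))
      then show ?thesis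
        using \<zeta>'(2) \<open>0 < e\<close> by (simp add: dist_norm)
    qed
    then show "\<exists>M. \<forall>n\<ge>M. dist (X n) (X N - \<zeta>) < e" by blast
  qed
  then show "convergent X" by (auto simp: convergent_def)
qed

section \<open>The complex inner product\<close>

lemma summable_cinner:
  "(\<lambda>a. cnj (ell2_apply \<xi> a) * ell2_apply \<eta> a) summable_on UNIV"
proof (rule abs_summable_summable, rule summable_on_comparison_test)
  show "(\<lambda>a. (cmod (ell2_apply \<xi> a))\<^sup>2 + (cmod (ell2_apply \<eta> a))\<^sup>2) summable_on UNIV"
    by (intro summable_on_add summable_ell2)
  fix a
  have "cmod (ell2_apply \<xi> a) * cmod (ell2_apply \<eta> a) * 2
      \<le> (cmod (ell2_apply \<xi> a))\<^sup>2 + (cmod (ell2_apply \<eta> a))\<^sup>2"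
    using sum_squares_bound[of "cmod (ell2_apply \<xi> a)" "cmod (ell2_apply \<eta> a)"]
    by (simp add: mult_ac)
  moreover have "0 \<le> cmod (ell2_apply \<xi> a) * cmod (ell2_apply \<eta> a)"
    by simp
  ultimately show "cmod (cnj (ell2_apply \<xi> a) * ell2_apply \<eta> a)
      \<le> (cmod (ell2_apply \<xi> a))\<^sup>2 + (cmod (ell2_apply \<eta> a))\<^sup>2"
    unfolding norm_mult complex_mod_cnj by linarith
qed auto

lemma cinner_eq: "cinner \<xi> \<eta> = (\<Sum>\<^sub>\<infinity>a. cnj (ell2_apply \<xi> a) * ell2_apply \<eta> a)"
  by transfer simp

lemma cinner_add_right: "cinner \<xi> (\<eta> + \<zeta>) = cinner \<xi> \<eta> + cinner \<xi> \<zeta>"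
  by (simp add: cinner_eq distrib_left infsum_add summable_cinner)

lemma cinner_add_left: "cinner (\<xi> + \<eta>) \<zeta> = cinner \<xi> \<zeta> + cinner \<eta> \<zeta>"
  by (simp add: cinner_eq distrib_right infsum_add summable_cinner)

lemma cinner_scale_right: "cinner \<xi> (scale_ell2 c \<eta>) = c * cinner \<xi> \<eta>"
  by (simp add: cinner_eq infsum_cmult_right' mult.left_commute)

lemma cinner_scale_left: "cinner (scale_ell2 c \<xi>) \<eta> = cnj c * cinner \<xi> \<eta>"
  by (simp add: cinner_eq infsum_cmult_right' mult.assoc)

lemma scaleR_eq_scale_ell2: "r *\<^sub>R \<xi> = scale_ell2 (complex_of_real r) \<xi>"
  by (rule ell2_eqI) simp

lemma cinner_commute: "cinner \<eta> \<xi> = cnj (cinner \<xi> \<eta>)"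
  by (simp add: cinner_eq mult.commute flip: infsum_cnj)

lemma Re_cinner: "Re (cinner \<xi> \<eta>) = \<xi> \<bullet> \<eta>"
proof -
  have "Re (cinner \<xi> \<eta>) = (\<Sum>\<^sub>\<infinity>a. Re (cnj (ell2_apply \<xi> a) * ell2_apply \<eta> a))"
    unfolding cinner_eq by (rule infsum_Re[OF summable_cinner, symmetric])
  also have "\<dots> = \<xi> \<bullet> \<eta>"
    by (simp add: inner_ell2.rep_eq inner_complex_def)
  finally show ?thesis .
qed

lemma cinner_self: "cinner \<xi> \<xi> = complex_of_real ((norm \<xi>)\<^sup>2)"
  using cinner_commute[of \<xi> \<xi>] Re_cinner[of \<xi> \<xi>]
  by (simp add: complex_eq_iff dot_square_norm)

text \<open>The real Cauchy-Schwarz inequality controls only the real part. Multiplying \<xi> by the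
  scalar \<open>cinner \<xi> \<eta>\<close> turns the product into the squared modulus, which is
  real.\<close>

lemma cmod_cinner_le: "cmod (cinner \<xi> \<eta>) \<le> norm \<xi> * norm \<eta>"
proof -
  have "complex_of_real (cmod (cinner \<xi> \<eta>)) * complex_of_real (cmod (cinner \<xi> \<eta>))
      = cinner (scale_ell2 (cinner \<xi> \<eta>) \<xi>) \<eta>"
    by (simp add: cinner_scale_left complex_norm_square[symmetric] power2_eq_square
        mult.commute[of "cnj _"])
  then have "cmod (cinner \<xi> \<eta>) * cmod (cinner \<xi> \<eta>) = scale_ell2 (cinner \<xi> \<eta>) \<xi> \<bullet> \<eta>"
    by (metis Re_complex_of_real Re_cinner of_real_mult)
  also have "\<dots> \<le> cmod (cinner \<xi> \<eta>) * (norm \<xi> * norm \<eta>)"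
    using norm_cauchy_schwarz[of "scale_ell2 (cinner \<xi> \<eta>) \<xi>" \<eta>]
    by (simp add: norm_scale_ell2 mult.assoc)
  finally show ?thesis
    by (cases "cinner \<xi> \<eta> = 0") auto
qed

interpretation cinner: bounded_bilinear cinner
proof
  show "\<exists>K. \<forall>a b. cmod (cinner a b) \<le> norm a * norm b * K"
    using cmod_cinner_le by (metis mult.right_neutral)
qed (simp_all add: cinner_add_left cinner_add_right scaleR_eq_scale_ell2 cinner_scale_left
    cinner_scale_right scaleR_conv_of_real)

lemma cinner_ext_right: "(\<And>\<xi>. cinner \<xi> \<eta> = cinner \<xi> \<zeta>) \<Longrightarrow> \<eta> = \<zeta>"
  using cinner_self[of "\<eta> - \<zeta>"] by (simp add: cinner.diff_right)

section \<open>Basis vectors and finite truncations\<close>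

lift_definition basis_ell2 :: "'a \<Rightarrow> 'a ell2" is "\<lambda>a b. if b = a then 1 else 0"
proof -
  fix a :: 'a
  have "(\<lambda>b. (cmod (if b = a then 1 else 0))\<^sup>2) summable_on {a}" by simp
  then show "(\<lambda>b. (cmod (if b = a then 1 else 0))\<^sup>2) summable_on UNIV"
    by (rule summable_on_cong_neutral[THEN iffD1, rotated -1]) auto
qed

lemma ell2_apply_basis [simp]: "ell2_apply (basis_ell2 a) b = (if b = a then 1 else 0)"
  by transfer simp

lemma ell2_apply_sum: "ell2_apply (\<Sum>i\<in>I. v i) a = (\<Sum>i\<in>I. ell2_apply (v i) a)"
  by (induction I rule: infinite_finite_induct) auto

definition finite_ell2 :: "'a set \<Rightarrow> ('a \<Rightarrow> complex) \<Rightarrow> 'a ell2" where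
  "finite_ell2 F f = (\<Sum>a\<in>F. scale_ell2 (f a) (basis_ell2 a))"

lemma ell2_apply_finite_ell2:
  "finite F \<Longrightarrow> ell2_apply (finite_ell2 F f) a = (if a \<in> F then f a else 0)"
  by (simp add: finite_ell2_def ell2_apply_sum if_distrib[of "(*) _"] cong: if_cong)

lemma norm_finite_ell2_sq:
  assumes "finite F"
  shows "(norm (finite_ell2 F f))\<^sup>2 = (\<Sum>a\<in>F. (cmod (f a))\<^sup>2)"
proof -
  have "(norm (finite_ell2 F f))\<^sup>2 = (\<Sum>\<^sub>\<infinity>a\<in>F. (cmod (f a))\<^sup>2)"
    unfolding norm_ell2_sq
    by (rule infsum_cong_neutral) (auto simp: ell2_apply_finite_ell2[OF assms])
  then show ?thesis using assms by simp
qed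

lemma cinner_basis: "cinner (basis_ell2 a) \<xi> = ell2_apply \<xi> a"
proof -
  have "cinner (basis_ell2 a) \<xi> = (\<Sum>\<^sub>\<infinity>b\<in>{a}. ell2_apply \<xi> b)"
    unfolding cinner_eq by (rule infsum_cong_neutral) auto
  then show ?thesis by simp
qed

text \<open>Density of finitely supported vectors. The limit runs along finite subsets, since the
  index set may be uncountable.\<close>

lemma finite_ell2_tendsto:
  "((\<lambda>F. finite_ell2 F (ell2_apply \<xi>)) \<longlongrightarrow> \<xi>) (finite_subsets_at_top UNIV)"
proof (rule Lim_null[THEN iffD2], rule tendsto_norm_zero_cancel)
  have eq: "sqrt ((norm \<xi>)\<^sup>2 - (\<Sum>a\<in>F. (cmod (ell2_apply \<xi> a))\<^sup>2)) = norm (finite_ell2 F (ell2_apply \<xi>) - \<xi>)"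
    if "finite F" for F
  proof -
    \<comment> \<open>Pythagoras: truncation and remainder have disjoint supports, so their squared
      moduli add up coordinate by coordinate.\<close>
    have "(norm \<xi>)\<^sup>2 = (\<Sum>\<^sub>\<infinity>a. (cmod (ell2_apply (finite_ell2 F (ell2_apply \<xi>) - \<xi>) a))\<^sup>2
        + (cmod (ell2_apply (finite_ell2 F (ell2_apply \<xi>)) a))\<^sup>2)"
      unfolding norm_ell2_sq by (rule infsum_cong) (simp add: ell2_apply_finite_ell2[OF that])
    also have "\<dots> = (norm (finite_ell2 F (ell2_apply \<xi>) - \<xi>))\<^sup>2 + (norm (finite_ell2 F (ell2_apply \<xi>)))\<^sup>2"
      unfolding norm_ell2_sq by (rule infsum_add[OF summable_ell2 summable_ell2])
    finally show ?thesis
      by (simp add: norm_finite_ell2_sq[OF that])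
  qed
  have "((\<lambda>F. sqrt ((norm \<xi>)\<^sup>2 - (\<Sum>a\<in>F. (cmod (ell2_apply \<xi> a))\<^sup>2)))
      \<longlongrightarrow> sqrt ((norm \<xi>)\<^sup>2 - (norm \<xi>)\<^sup>2)) (finite_subsets_at_top UNIV)"
    using has_sum_infsum[OF summable_ell2[of \<xi>]]
    by (intro tendsto_intros) (simp add: has_sum_def norm_ell2_sq)
  moreover have "\<forall>\<^sub>F F in finite_subsets_at_top UNIV.
      sqrt ((norm \<xi>)\<^sup>2 - (\<Sum>a\<in>F. (cmod (ell2_apply \<xi> a))\<^sup>2)) = norm (finite_ell2 F (ell2_apply \<xi>) - \<xi>)"
    by (rule eventually_finite_subsets_at_top_weakI) (rule eq)
  ultimately show "((\<lambda>F. norm (finite_ell2 F (ell2_apply \<xi>) - \<xi>)) \<longlongrightarrow> 0) (finite_subsets_at_top UNIV)"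
    by (simp add: filterlim_cong[OF refl refl])
qed

section \<open>Adjoints\<close>

lemma blinfun_apply_scale_op [simp]:
  "blinfun_apply (scale_op c x) \<xi> = scale_ell2 c (blinfun_apply x \<xi>)"
  by (simp add: scale_op_def scalar_op.rep_eq)

lemma scale_ell2_add: "scale_ell2 c (\<xi> + \<eta>) = scale_ell2 c \<xi> + scale_ell2 c \<eta>"
  by (rule ell2_eqI) (simp add: algebra_simps)

lemma scale_ell2_scale_ell2: "scale_ell2 c (scale_ell2 d \<xi>) = scale_ell2 (c * d) \<xi>"
  by (rule ell2_eqI) (simp add: algebra_simps)

lemma scale_op_of_real: "scale_op (complex_of_real r) x = r *\<^sub>R x"
  by (rule blinfun_eqI) (simp add: scaleR_eq_scale_ell2 blinfun.scaleR_left)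

lemma scale_op_add: "scale_op c (x + y) = scale_op c x + scale_op c y"
  by (rule blinfun_eqI) (simp add: scale_ell2_add blinfun.add_left)

lemma scale_op_zero: "scale_op c 0 = 0"
  by (simp add: scale_op_def)

lemma scale_op_diff: "scale_op c (x - y) = scale_op c x - scale_op c y"
  by (simp add: scale_op_def bounded_bilinear.diff_right[OF bounded_bilinear_blinfun_compose])

lemma scale_op_sum: "scale_op c (\<Sum>i\<in>I. v i) = (\<Sum>i\<in>I. scale_op c (v i))"
  by (induction I rule: infinite_finite_induct) (auto simp: scale_op_zero scale_op_add)

lemma scale_op_scale_op: "scale_op c (scale_op d x) = scale_op (c * d) x"
  by (rule blinfun_eqI) (simp add: scale_ell2_scale_ell2)

lemma norm_scale_op_le: "norm (scale_op c x) \<le> cmod c * norm x"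
proof (rule norm_blinfun_bound)
  fix \<xi>
  show "norm (blinfun_apply (scale_op c x) \<xi>) \<le> cmod c * norm x * norm \<xi>"
    using norm_blinfun[of x \<xi>] by (simp add: norm_scale_ell2 mult.assoc mult_left_mono)
qed simp

lemma clinear_opD: "clinear_op x \<Longrightarrow>
    blinfun_apply x (scale_ell2 c \<xi>) = scale_ell2 c (blinfun_apply x \<xi>)"
  by (simp add: clinear_op_def)

lemma clinear_op_intros:
  "clinear_op 0"
  "clinear_op x \<Longrightarrow> clinear_op y \<Longrightarrow> clinear_op (x + y)"
  "clinear_op x \<Longrightarrow> clinear_op (scale_op c x)"
  "clinear_op x \<Longrightarrow> clinear_op y \<Longrightarrow> clinear_op (x o\<^sub>L y)"
proof -
  have "scale_ell2 c (0 :: 'a ell2) = 0" for c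
    by (rule ell2_eqI) simp
  then show "clinear_op (0 :: 'a operator)"
    by (simp add: clinear_op_def)
qed (simp_all add: clinear_op_def blinfun.add_left scale_ell2_add scale_ell2_scale_ell2 mult.commute)

lemma closed_clinear_op: "closed {x :: 'a operator. clinear_op x}"
proof -
  have scale: "scale_ell2 c \<xi> = blinfun_apply (scalar_op c) \<xi>" for c and \<xi> :: "'a ell2"
    by (simp add: scalar_op.rep_eq)
  show ?thesis
    unfolding clinear_op_def scale
    by (intro closed_Collect_all closed_Collect_eq continuous_intros)
qed

text \<open>The coordinates of the adjoint at \<eta> are forced: pairing with the basis vector at a
  must give \<open>f \<eta> a\<close>. What remains is that they are square summable, with norm at
  most \<open>norm \<eta> * norm x\<close>.\<close>

lemma adjoint_exists:
  fixes x :: "'a operator"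
  assumes x: "clinear_op x"
  obtains y where
    "\<And>\<xi> \<eta>. cinner (blinfun_apply x \<xi>) \<eta> = cinner \<xi> (blinfun_apply y \<eta>)"
proof -
  define f where "f \<eta> a = cinner (blinfun_apply x (basis_ell2 a)) \<eta>" for \<eta> a
  have fin: "cinner (blinfun_apply x (finite_ell2 F h)) \<eta> = (\<Sum>a\<in>F. cnj (h a) * f \<eta> a)" for F h \<eta>
    by (simp add: finite_ell2_def blinfun.sum_right cinner.sum_left clinear_opD[OF x]
        cinner_scale_left f_def)
  have "\<exists>\<zeta>. ell2_apply \<zeta> = f \<eta> \<and> norm \<zeta> \<le> norm \<eta> * norm x" for \<eta>
  proof -
    have "(\<Sum>a\<in>F. (cmod (f \<eta> a))\<^sup>2) \<le> (norm \<eta> * norm x)\<^sup>2" if F: "finite F" for F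
    proof -
      \<comment> \<open>Applying x to the truncation of \<open>f \<eta>\<close> itself turns the
        pairing with \<eta> into the squared norm of that truncation. Cauchy-Schwarz bounds it by a
        multiple of N, and one factor N cancels.\<close>
      define N where "N = norm (finite_ell2 F (f \<eta>))"
      have N2: "N\<^sup>2 = (\<Sum>a\<in>F. (cmod (f \<eta> a))\<^sup>2)"
        by (simp add: N_def norm_finite_ell2_sq[OF F])
      have "cinner (blinfun_apply x (finite_ell2 F (f \<eta>))) \<eta> = complex_of_real (N\<^sup>2)"
        unfolding fin N2
        by (simp add: complex_norm_square mult.commute del: of_real_power)
      then have "N\<^sup>2 = cmod (cinner (blinfun_apply x (finite_ell2 F (f \<eta>))) \<eta>)"
        by (simp add: norm_power)
      also have "\<dots> \<le> norm (blinfun_apply x (finite_ell2 F (f \<eta>))) * norm \<eta>"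
        by (rule cmod_cinner_le)
      also have "\<dots> \<le> norm x * N * norm \<eta>"
        unfolding N_def by (intro mult_right_mono norm_blinfun) auto
      finally have "N * N \<le> (norm \<eta> * norm x) * N"
        by (simp add: power2_eq_square mult_ac)
      moreover have "0 \<le> N" by (simp add: N_def)
      ultimately have "N \<le> norm \<eta> * norm x"
        by (cases "N = 0") auto
      then have "N\<^sup>2 \<le> (norm \<eta> * norm x)\<^sup>2"
        using \<open>0 \<le> N\<close> by (rule power_mono)
      then show ?thesis by (simp add: N2)
    qed
    then show ?thesis
      using ell2_exI[of "norm \<eta> * norm x"] by (metis mult_nonneg_nonneg norm_ge_zero)
  qed
  then obtain g where g: "\<And>\<eta>. ell2_apply (g \<eta>) = f \<eta>" "\<And>\<eta>. norm (g \<eta>) \<le> norm \<eta> * norm x"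
    by metis
  have "bounded_linear g"
    by (rule bounded_linear_intro[where K = "norm x"])
      (auto intro!: ell2_eqI g(2) simp: g(1) f_def cinner.add_right cinner.scaleR_right
        scaleR_conv_of_real)
  then have app: "blinfun_apply (Blinfun g) = g"
    by (rule bounded_linear_Blinfun_apply)
  show thesis
  proof
    fix \<xi> \<eta> :: "'a ell2"
    \<comment> \<open>On truncations of \<xi> the identity is one of finite sums, and both sides are
      continuous in \<xi>.\<close>
    let ?t = "\<lambda>F. finite_ell2 F (ell2_apply \<xi>)"
    have "cinner (blinfun_apply x (?t F)) \<eta> = cinner (?t F) (g \<eta>)" for F
      unfolding fin
      by (simp add: finite_ell2_def cinner.sum_left cinner_scale_left cinner_basis g(1))
    moreover have "((\<lambda>F. cinner (blinfun_apply x (?t F)) \<eta>)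
        \<longlongrightarrow> cinner (blinfun_apply x \<xi>) \<eta>) (finite_subsets_at_top UNIV)"
      by (intro cinner.tendsto blinfun.tendsto finite_ell2_tendsto tendsto_const)
    moreover have "((\<lambda>F. cinner (?t F) (g \<eta>)) \<longlongrightarrow> cinner \<xi> (g \<eta>)) (finite_subsets_at_top UNIV)"
      by (intro cinner.tendsto finite_ell2_tendsto tendsto_const)
    ultimately show "cinner (blinfun_apply x \<xi>) \<eta> = cinner \<xi> (blinfun_apply (Blinfun g) \<eta>)"
      unfolding app using tendsto_unique[OF finite_subsets_at_top_neq_bot] by auto
  qed
qed

text \<open>Unfolds the description in \<open>adj\<close> once and for all: afterwards every law of
  adjoints is a check of the defining equation for a candidate.\<close>

lemma adj_eqI:
  assumes "\<And>\<xi> \<eta>. cinner (blinfun_apply x \<xi>) \<eta> = cinner \<xi> (blinfun_apply y \<eta>)"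
  shows "adj x = y"
  unfolding adj_def
proof (rule the_equality)
  show "\<forall>\<xi> \<eta>. cinner (blinfun_apply x \<xi>) \<eta> = cinner \<xi> (blinfun_apply y \<eta>)"
    using assms by blast
  fix z
  assume "\<forall>\<xi> \<eta>. cinner (blinfun_apply x \<xi>) \<eta> = cinner \<xi> (blinfun_apply z \<eta>)"
  then show "z = y"
    using assms by (intro blinfun_eqI cinner_ext_right) metis
qed

lemma cinner_adj_right:
  assumes "clinear_op x"
  shows "cinner \<xi> (blinfun_apply (adj x) \<eta>) = cinner (blinfun_apply x \<xi>) \<eta>"
proof -
  obtain y where y: "\<And>\<xi> \<eta>. cinner (blinfun_apply x \<xi>) \<eta> = cinner \<xi> (blinfun_apply y \<eta>)"
    using adjoint_exists[OF assms] by blast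
  then have "adj x = y"
    by (rule adj_eqI)
  with y show ?thesis
    by simp
qed

lemma cinner_adj_left:
  "clinear_op x \<Longrightarrow> cinner (blinfun_apply (adj x) \<xi>) \<eta> = cinner \<xi> (blinfun_apply x \<eta>)"
  by (metis cinner_adj_right cinner_commute)

lemma adj_add: "clinear_op x \<Longrightarrow> clinear_op y \<Longrightarrow> adj (x + y) = adj x + adj y"
  by (rule adj_eqI) (simp add: blinfun.add_left cinner.add_left cinner.add_right cinner_adj_right)

lemma adj_scale: "clinear_op x \<Longrightarrow> adj (scale_op c x) = scale_op (cnj c) (adj x)"
  by (rule adj_eqI) (simp add: cinner_scale_left cinner_scale_right cinner_adj_right)

lemma adj_compose: "clinear_op x \<Longrightarrow> clinear_op y \<Longrightarrow> adj (x o\<^sub>L y) = adj y o\<^sub>L adj x"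
  by (rule adj_eqI) (simp add: cinner_adj_right)

lemma adj_adj: "clinear_op x \<Longrightarrow> adj (adj x) = x"
  by (rule adj_eqI) (simp add: cinner_adj_left)

lemma norm_adj_le:
  assumes x: "clinear_op x"
  shows "norm (adj x) \<le> norm x"
proof (rule norm_blinfun_bound)
  fix \<eta>
  let ?\<xi> = "blinfun_apply (adj x) \<eta>"
  have "(norm ?\<xi>)\<^sup>2 = cmod (cinner (blinfun_apply x ?\<xi>) \<eta>)"
    unfolding cinner_adj_right[OF x, symmetric] cinner_self by (simp add: norm_power)
  also have "\<dots> \<le> norm x * norm ?\<xi> * norm \<eta>"
    using cmod_cinner_le[of "blinfun_apply x ?\<xi>" \<eta>]
      mult_right_mono[OF norm_blinfun[of x ?\<xi>] norm_ge_zero[of \<eta>]] by linarith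
  finally have "norm ?\<xi> * norm ?\<xi> \<le> (norm x * norm \<eta>) * norm ?\<xi>"
    by (simp add: power2_eq_square mult_ac)
  then show "norm ?\<xi> \<le> norm x * norm \<eta>"
    by (cases "norm ?\<xi> = 0") auto
qed simp

section \<open>The left regular representation\<close>

lemma adj_left_regular: "adj (left_regular g) = left_regular (- g)"
proof (rule adj_eqI)
  fix \<xi> \<eta> :: "'a ell2"
  have app: "ell2_apply (blinfun_apply (left_regular g) \<xi>) h = ell2_apply \<xi> (- g + h)"
    for g h :: 'a and \<xi>
    by (simp add: left_regular.rep_eq translate.rep_eq)
  \<comment> \<open>Writing h as g + (- g + h) makes the summand a function of - g + h alone, ready
    for reindexing by the translation.\<close>
  have "cinner (blinfun_apply (left_regular g) \<xi>) \<eta>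
      = (\<Sum>\<^sub>\<infinity>h. cnj (ell2_apply \<xi> (- g + h)) * ell2_apply \<eta> (g + (- g + h)))"
    by (simp add: cinner_eq app add.assoc[symmetric])
  also have "\<dots> = (\<Sum>\<^sub>\<infinity>h. cnj (ell2_apply \<xi> h) * ell2_apply \<eta> (g + h))"
    by (rule infsum_reindex_bij_betw[OF bij_left_translation])
  also have "\<dots> = cinner \<xi> (blinfun_apply (left_regular (- g)) \<eta>)"
    by (simp add: cinner_eq app)
  finally show "cinner (blinfun_apply (left_regular g) \<xi>) \<eta>
      = cinner \<xi> (blinfun_apply (left_regular (- g)) \<eta>)" .
qed

lemma clinear_op_left_regular: "clinear_op (left_regular g)"
  unfolding clinear_op_def
  by (auto intro!: ell2_eqI simp: left_regular.rep_eq translate.rep_eq)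

lemma left_regular_compose: "left_regular g o\<^sub>L left_regular h = left_regular (g + h)"
  by (auto intro!: blinfun_eqI ell2_eqI
      simp: left_regular.rep_eq translate.rep_eq minus_add add.assoc diff_conv_add_uminus
      simp del: add_uminus_conv_diff)

lemma left_regular_0: "left_regular 0 = id_blinfun"
  by (auto intro!: blinfun_eqI ell2_eqI simp: left_regular.rep_eq translate.rep_eq)

section \<open>Closed spaces of operators and the reduced algebra\<close>

text \<open>\<open>cstar_algebra\<close> without products and adjoints: the structure that sets cut
  out by linear limit conditions do have.\<close>

definition operator_space :: "'a operator set \<Rightarrow> bool" where
  "operator_space S \<longleftrightarrow>
    (\<forall>x\<in>S. clinear_op x) \<and> 0 \<in> S \<and> (\<forall>x\<in>S. \<forall>y\<in>S. x + y \<in> S) \<and>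
    (\<forall>c. \<forall>x\<in>S. scale_op c x \<in> S) \<and> closed S"

lemma operator_spaceD:
  assumes "operator_space S"
  shows "x \<in> S \<Longrightarrow> clinear_op x" "0 \<in> S" "x \<in> S \<Longrightarrow> y \<in> S \<Longrightarrow> x + y \<in> S"
    "x \<in> S \<Longrightarrow> scale_op c x \<in> S" "closed S"
  using assms by (auto simp: operator_space_def)

lemma operator_space_scaleR: "operator_space S \<Longrightarrow> x \<in> S \<Longrightarrow> r *\<^sub>R x \<in> S"
  by (metis operator_spaceD(4) scale_op_of_real)

lemma operator_space_diff: "operator_space S \<Longrightarrow> x \<in> S \<Longrightarrow> y \<in> S \<Longrightarrow> x - y \<in> S"
  using operator_space_scaleR[of S y "-1"] operator_spaceD(3)[of S x "- y"] by simp

lemma operator_space_sum: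
  "operator_space S \<Longrightarrow> (\<And>i. i \<in> I \<Longrightarrow> v i \<in> S) \<Longrightarrow> (\<Sum>i\<in>I. v i) \<in> S"
  by (induction I rule: infinite_finite_induct) (auto intro: operator_spaceD)

lemma operator_space_clinear: "operator_space {x. clinear_op x}"
  by (auto simp: operator_space_def closed_clinear_op intro: clinear_op_intros)

lemma additive_on_simps:
  fixes f :: "'a operator \<Rightarrow> 'b::ab_group_add"
  assumes "operator_space T" and add: "\<And>x y. x \<in> T \<Longrightarrow> y \<in> T \<Longrightarrow> f (x + y) = f x + f y"
  shows "f 0 = 0"
    and "x \<in> T \<Longrightarrow> y \<in> T \<Longrightarrow> f (x - y) = f x - f y"
    and "(\<And>i. i \<in> I \<Longrightarrow> v i \<in> T) \<Longrightarrow> f (\<Sum>i\<in>I. v i) = (\<Sum>i\<in>I. f (v i))"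
proof -
  show "f 0 = 0"
    using add[of 0 0] operator_spaceD(2)[OF assms(1)] by simp
  then show "(\<And>i. i \<in> I \<Longrightarrow> v i \<in> T) \<Longrightarrow> f (\<Sum>i\<in>I. v i) = (\<Sum>i\<in>I. f (v i))"
    by (induction I rule: infinite_finite_induct)
      (auto simp: add operator_space_sum[OF assms(1)])
  show "x \<in> T \<Longrightarrow> y \<in> T \<Longrightarrow> f (x - y) = f x - f y"
    using add[of "x - y" y] operator_space_diff[OF assms(1), of x y] by simp
qed

text \<open>Continuity relative to T. An automorphism is unconstrained outside the algebra, and
  \<open>adj\<close> is meaningful only on complex-linear operators, so neither is a bounded linear
  map on all operators.\<close>

lemma additive_on_tendsto:
  fixes f :: "'a operator \<Rightarrow> 'b::real_normed_vector"
  assumes "operator_space T" and "\<And>x y. x \<in> T \<Longrightarrow> y \<in> T \<Longrightarrow> f (x + y) = f x + f y"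
    and bound: "\<And>x. x \<in> T \<Longrightarrow> norm (f x) \<le> K * norm x"
    and X: "X \<longlonglongrightarrow> x" "\<And>n. X n \<in> T" "x \<in> T"
  shows "(\<lambda>n. f (X n)) \<longlonglongrightarrow> f x"
proof (rule Lim_null[THEN iffD2], rule Lim_null_comparison)
  have "norm (f (X n) - f x) \<le> K * norm (X n - x)" for n
    using bound[of "X n - x"] additive_on_simps(2)[of T f, OF assms(1,2)]
      operator_space_diff[OF assms(1)] X by simp
  then show "\<forall>\<^sub>F n in sequentially. norm (f (X n) - f x) \<le> K * norm (X n - x)"
    by simp
  show "(\<lambda>n. K * norm (X n - x)) \<longlonglongrightarrow> 0"
    using X(1) by (intro tendsto_mult_right_zero tendsto_norm_zero) (simp add: Lim_null[symmetric])
qed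

text \<open>The map \<sigma> on scalars admits conjugate-linear f, so that \<open>adj\<close> is
  covered along with multiplication by a fixed operator.\<close>

lemma operator_space_vimage:
  fixes f :: "'a operator \<Rightarrow> 'a operator"
  assumes T: "operator_space T" and S: "operator_space S"
    and add: "\<And>x y. x \<in> T \<Longrightarrow> y \<in> T \<Longrightarrow> f (x + y) = f x + f y"
    and scale: "\<And>c x. x \<in> T \<Longrightarrow> f (scale_op c x) = scale_op (\<sigma> c) (f x)"
    and bound: "\<And>x. x \<in> T \<Longrightarrow> norm (f x) \<le> K * norm x"
  shows "operator_space {x \<in> T. f x \<in> S}"
proof -
  have "closed {x \<in> T. f x \<in> S}"
  proof (rule closed_sequential_limits[THEN iffD2], intro allI impI, elim conjE)
    fix X x
    assume X: "\<forall>n. X n \<in> {x \<in> T. f x \<in> S}" "X \<longlonglongrightarrow> x"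
    then have x: "x \<in> T"
      using closed_sequentially[OF operator_spaceD(5)[OF T]] by blast
    have "(\<lambda>n. f (X n)) \<longlonglongrightarrow> f x"
      by (rule additive_on_tendsto[where f = f, OF T add bound]) (use X x in auto)
    then have "f x \<in> S"
      using X closed_sequentially[OF operator_spaceD(5)[OF S], of "\<lambda>n. f (X n)"] by blast
    with x show "x \<in> {x \<in> T. f x \<in> S}" by simp
  qed
  then show ?thesis
    using operator_spaceD[OF T] operator_spaceD[OF S] additive_on_simps(1)[of T f, OF T add]
    by (simp add: operator_space_def add scale)
qed

text \<open>The uniform constant K makes the family equicontinuous, and this gives closedness by
  approximation. The general filter serves both sequences and pairs of indices. Homogeneity is asked
  for only in norm, so that scalar and operator values are treated alike.\<close>

lemma operator_space_tendsto_zero: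
  fixes f :: "'i \<Rightarrow> 'a operator \<Rightarrow> 'b::real_normed_vector"
  assumes T: "operator_space T"
    and add: "\<And>i x y. x \<in> T \<Longrightarrow> y \<in> T \<Longrightarrow> f i (x + y) = f i x + f i y"
    and scale: "\<And>i c x. x \<in> T \<Longrightarrow> norm (f i (scale_op c x)) \<le> cmod c * norm (f i x)"
    and bound: "\<And>i x. x \<in> T \<Longrightarrow> norm (f i x) \<le> K * norm x"
  shows "operator_space {x \<in> T. ((\<lambda>i. f i x) \<longlongrightarrow> 0) F}"
proof -
  have "((\<lambda>i. f i (scale_op c x)) \<longlongrightarrow> 0) F" if "x \<in> T" "((\<lambda>i. f i x) \<longlongrightarrow> 0) F" for c x
  proof (rule Lim_null_comparison)
    show "\<forall>\<^sub>F i in F. norm (f i (scale_op c x)) \<le> cmod c * norm (f i x)"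
      by (simp add: scale that)
    show "((\<lambda>i. cmod c * norm (f i x)) \<longlongrightarrow> 0) F"
      by (intro tendsto_mult_right_zero tendsto_norm_zero that)
  qed
  moreover have "closed {x \<in> T. ((\<lambda>i. f i x) \<longlongrightarrow> 0) F}"
  proof (rule closed_sequential_limits[THEN iffD2], intro allI impI, elim conjE)
    fix X x
    assume X: "\<forall>n. X n \<in> {x \<in> T. ((\<lambda>i. f i x) \<longlongrightarrow> 0) F}" "X \<longlonglongrightarrow> x"
    then have x: "x \<in> T"
      using closed_sequentially[OF operator_spaceD(5)[OF T]] by blast
    have "((\<lambda>i. f i x) \<longlongrightarrow> 0) F"
    proof (rule tendstoI)
      fix e :: real assume "0 < e"
      have "(\<lambda>n. K * norm (x - X n)) \<longlonglongrightarrow> K * norm (x - x)"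
        by (intro tendsto_intros X)
      then have "\<forall>\<^sub>F n in sequentially. K * norm (x - X n) < e / 2"
        by (rule order_tendstoD(2)) (use \<open>0 < e\<close> in simp)
      then obtain n where n: "K * norm (x - X n) < e / 2"
        by (auto simp: eventually_sequentially)
      have Xn: "X n \<in> T" "((\<lambda>i. f i (X n)) \<longlongrightarrow> 0) F"
        using X by auto
      have "\<forall>\<^sub>F i in F. norm (f i (X n)) < e / 2"
        using tendstoD[OF Xn(2), of "e / 2"] \<open>0 < e\<close> by simp
      then show "\<forall>\<^sub>F i in F. dist (f i x) 0 < e"
      proof eventually_elim
        case (elim i)
        have "norm (f i x) \<le> norm (f i (x - X n)) + norm (f i (X n))"
          using norm_triangle_sub[of "f i x" "f i (X n)"]
            additive_on_simps(2)[of T "f i", OF T add x Xn(1)] by simp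
        also have "\<dots> < e"
          using bound[OF operator_space_diff[OF T x Xn(1)], of i] n elim by linarith
        finally show ?case by simp
      qed
    qed
    with x show "x \<in> {x \<in> T. ((\<lambda>i. f i x) \<longlongrightarrow> 0) F}" by simp
  qed
  moreover have "((\<lambda>i. f i (x + y)) \<longlongrightarrow> 0) F"
    if "x \<in> T" "((\<lambda>i. f i x) \<longlongrightarrow> 0) F" "y \<in> T" "((\<lambda>i. f i y) \<longlongrightarrow> 0) F" for x y
    using tendsto_add[OF that(2,4)] that by (simp add: add)
  moreover have "f i 0 = 0" for i
    by (rule additive_on_simps(1)[OF T]) (rule add)
  ultimately show ?thesis
    using operator_spaceD[OF T] unfolding operator_space_def by simp
qed

section \<open>The reduced algebra as a closed linear span\<close>

lemma operator_space_cstar_algebra: "cstar_algebra A \<Longrightarrow> operator_space A"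
  by (simp add: cstar_algebra_def operator_space_def)

text \<open>The hull is an intersection, and it would be everything if no operator space contained
  X. The space of all complex-linear operators prevents this.\<close>

lemma operator_space_hull:
  assumes "\<And>x. x \<in> X \<Longrightarrow> clinear_op x"
  shows "operator_space (operator_space hull X)"
proof -
  have "x \<in> {x. clinear_op x}" if "x \<in> operator_space hull X" for x
    using that hull_minimal[of X "{x. clinear_op x}" operator_space] operator_space_clinear assms
    by blast
  then show ?thesis
    unfolding operator_space_def[of "operator_space hull X"]
    by (auto simp: hull_def intro!: closed_Inter intro: operator_spaceD)
qed

text \<open>Products are handled one factor at a time: first the left factor is a group unitary and
  the right one varies over the span, then the right factor is arbitrary and the left one varies.
  Each stage holds because a preimage of the span under a bounded linear map is again an operator
  space; adjoints use a conjugate-linear one.\<close>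

lemma cstar_algebra_operator_space_hull:
  "cstar_algebra (operator_space hull range left_regular)" (is "cstar_algebra ?B")
proof -
  have B: "operator_space ?B"
    by (rule operator_space_hull) (auto intro: clinear_op_left_regular)
  have lr: "left_regular g \<in> ?B" for g
    by (simp add: hull_inc)
  have sub: "x \<in> S" if "x \<in> ?B" "operator_space S" "range left_regular \<subseteq> S" for x S
    using that hull_minimal[of "range left_regular" S operator_space] by blast
  have left: "left_regular g o\<^sub>L x \<in> ?B" if "x \<in> ?B" for g x
  proof -
    have "operator_space {x \<in> ?B. left_regular g o\<^sub>L x \<in> ?B}"
    proof (rule operator_space_vimage[OF B B])
      show "left_regular g o\<^sub>L scale_op c x = scale_op c (left_regular g o\<^sub>L x)" for c x
        by (rule blinfun_eqI) (simp add: clinear_opD[OF clinear_op_left_regular])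
      show "norm (left_regular g o\<^sub>L x) \<le> norm (left_regular g) * norm x" for x :: "'a operator"
        by (rule norm_blinfun_compose)
    qed (rule bounded_bilinear.add_right[OF bounded_bilinear_blinfun_compose])
    then have "x \<in> {x \<in> ?B. left_regular g o\<^sub>L x \<in> ?B}"
      by (rule sub[OF that]) (auto simp: lr left_regular_compose)
    then show ?thesis by simp
  qed
  have mult: "x o\<^sub>L y \<in> ?B" if "x \<in> ?B" "y \<in> ?B" for x y
  proof -
    have "operator_space {x \<in> ?B. x o\<^sub>L y \<in> ?B}"
    proof (rule operator_space_vimage[OF B B])
      show "scale_op c x o\<^sub>L y = scale_op c (x o\<^sub>L y)" for c x
        by (rule blinfun_eqI) simp
      show "norm (x o\<^sub>L y) \<le> norm y * norm x" for x :: "'a operator"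
        using norm_blinfun_compose[of x y] by (simp add: mult.commute)
    qed (rule bounded_bilinear.add_left[OF bounded_bilinear_blinfun_compose])
    then have "x \<in> {x \<in> ?B. x o\<^sub>L y \<in> ?B}"
      by (rule sub[OF that(1)]) (auto simp: lr left that)
    then show ?thesis by simp
  qed
  have "adj x \<in> ?B" if "x \<in> ?B" for x
  proof -
    have "operator_space {x \<in> ?B. adj x \<in> ?B}"
    proof (rule operator_space_vimage[OF B B])
      show "norm (adj x) \<le> 1 * norm x" if "x \<in> ?B" for x
        using norm_adj_le operator_spaceD(1)[OF B that] by simp
    qed (auto intro: adj_add adj_scale dest: operator_spaceD(1)[OF B])
    then have "x \<in> {x \<in> ?B. adj x \<in> ?B}"
      by (rule sub[OF that]) (auto simp: lr adj_left_regular)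
    then show ?thesis by simp
  qed
  with mult operator_spaceD[OF B] show ?thesis
    by (simp add: cstar_algebra_def)
qed

lemma reduced_cstar_algebra_eq:
  "reduced_cstar_algebra = operator_space hull range left_regular"
proof
  show "reduced_cstar_algebra \<subseteq> operator_space hull range left_regular"
    unfolding reduced_cstar_algebra_def
    by (intro hull_minimal hull_subset cstar_algebra_operator_space_hull)
  show "operator_space hull range left_regular \<subseteq> reduced_cstar_algebra"
    unfolding reduced_cstar_algebra_def hull_def[of cstar_algebra]
    by (auto intro: operator_space_cstar_algebra dest: hull_minimal[of _ _ operator_space])
qed

lemma cstar_algebra_reduced: "cstar_algebra reduced_cstar_algebra"
  unfolding reduced_cstar_algebra_eq by (rule cstar_algebra_operator_space_hull)

lemma left_regular_in_reduced: "left_regular g \<in> reduced_cstar_algebra"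
  by (simp add: reduced_cstar_algebra_def hull_inc)

text \<open>The gain from the identification with a span: the induction has no case for products or
  adjoints.\<close>

lemma reduced_cstar_algebra_induct:
  assumes "x \<in> reduced_cstar_algebra" "operator_space {x \<in> reduced_cstar_algebra. P x}"
    and "\<And>g. P (left_regular g)"
  shows "P x"
proof -
  have "reduced_cstar_algebra \<subseteq> {x \<in> reduced_cstar_algebra. P x}"
    unfolding reduced_cstar_algebra_eq
    by (rule hull_minimal)
      (use assms left_regular_in_reduced in \<open>auto simp: reduced_cstar_algebra_eq[symmetric]\<close>)
  then show ?thesis using assms(1) by blast
qed

section \<open>Automorphisms are contractive\<close>

lemma cstar_algebraD:
  assumes "cstar_algebra A"
  shows "x \<in> A \<Longrightarrow> y \<in> A \<Longrightarrow> x o\<^sub>L y \<in> A" "x \<in> A \<Longrightarrow> adj x \<in> A"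
  using assms by (auto simp: cstar_algebra_def)

text \<open>The equation says \<open>(1 - y)\<^sup>2 = 1 - a\<close>: a square root of \<open>1 - a\<close> inside the algebra, without
  functional calculus.\<close>

lemma self_adjoint_fixed_point:
  assumes A: "cstar_algebra A" and a: "a \<in> A" "adj a = a" "norm a < 1"
  obtains y where "y \<in> A" "adj y = y" "y + y = a + (y o\<^sub>L y)"
proof -
  note sp = operator_space_cstar_algebra[OF A]
  \<comment> \<open>The radius \<open>norm a\<close> works twice: with \<open>norm a < 1\<close> the
    ball is mapped into itself by f, since (\<open>norm a\<close> + \<open>norm a\<close> squared) /
    2 is at most \<open>norm a\<close>; and on it f contracts distances by the factor
    \<open>norm a\<close>.\<close>
  define S where "S = {y \<in> A. adj y = y \<and> norm y \<le> norm a}"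
  define f where "f y = (1/2) *\<^sub>R (a + (y o\<^sub>L y))" for y
  have cl: "clinear_op x" if "x \<in> A" for x
    using operator_spaceD(1)[OF sp that] .
  have "closed S"
    unfolding closed_sequential_limits
  proof (intro allI impI, elim conjE)
    fix X y
    assume X: "\<forall>n. X n \<in> S" "X \<longlonglongrightarrow> y"
    then have y: "y \<in> A"
      using closed_sequentially[OF operator_spaceD(5)[OF sp], of X y] by (auto simp: S_def)
    have "(\<lambda>n. adj (X n)) \<longlonglongrightarrow> adj y"
      by (rule additive_on_tendsto[OF sp, where f = adj and K = 1])
        (use X y in \<open>auto simp: S_def cl adj_add norm_adj_le\<close>)
    moreover have "(\<lambda>n. adj (X n)) = X"
      using X(1) by (auto simp: S_def)
    ultimately have "adj y = y"
      using X(2) LIMSEQ_unique by metis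
    moreover have "norm y \<le> norm a"
      using X by (intro LIMSEQ_le_const2[OF tendsto_norm[OF X(2)]]) (auto simp: S_def)
    ultimately show "y \<in> S" using y by (simp add: S_def)
  qed
  then have "complete S"
    by (simp add: complete_eq_closed)
  moreover have "S \<noteq> {}"
    using a(1,2) by (auto simp: S_def)
  moreover have "f ` S \<subseteq> S"
  proof safe
    fix y assume "y \<in> S"
    then have y: "y \<in> A" "adj y = y" "norm y \<le> norm a" by (auto simp: S_def)
    have yy: "y o\<^sub>L y \<in> A"
      by (rule cstar_algebraD(1)[OF A y(1) y(1)])
    have "norm (y o\<^sub>L y) \<le> norm y * norm y"
      by (rule norm_blinfun_compose)
    also have "\<dots> \<le> norm a * 1"
      using y(3) a(3) by (intro mult_mono) auto
    finally have "norm (f y) \<le> norm a"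
      using norm_triangle_ineq[of a "y o\<^sub>L y"] by (simp add: f_def)
    moreover have "f y \<in> A"
      unfolding f_def by (intro operator_space_scaleR operator_spaceD(3) sp a yy)
    moreover have "adj (f y) = f y"
      unfolding f_def scale_op_of_real[symmetric]
      by (simp add: adj_scale adj_add adj_compose cl clinear_op_intros y a yy)
    ultimately show "f y \<in> S" by (simp add: S_def)
  qed
  moreover have "\<forall>y\<in>S. \<forall>z\<in>S. dist (f y) (f z) \<le> norm a * dist y z"
  proof (intro ballI)
    fix y z assume "y \<in> S" "z \<in> S"
    then have yz: "norm y \<le> norm a" "norm z \<le> norm a" by (auto simp: S_def)
    \<comment> \<open>The two operators need not commute, so the difference of squares is split as y
      (y - z) + (y - z) z.\<close>
    have "f y - f z = (1/2) *\<^sub>R ((y o\<^sub>L (y - z)) + ((y - z) o\<^sub>L z))"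
      by (simp add: f_def algebra_simps bounded_bilinear.diff_right[OF bounded_bilinear_blinfun_compose]
          bounded_bilinear.diff_left[OF bounded_bilinear_blinfun_compose])
    then have "dist (f y) (f z) = norm ((y o\<^sub>L (y - z)) + ((y - z) o\<^sub>L z)) / 2"
      by (simp add: dist_norm)
    also have "norm ((y o\<^sub>L (y - z)) + ((y - z) o\<^sub>L z)) \<le> norm y * norm (y - z) + norm (y - z) * norm z"
      by (intro norm_triangle_mono norm_blinfun_compose)
    also have "\<dots> \<le> norm a * norm (y - z) + norm (y - z) * norm a"
      by (intro add_mono mult_mono yz) auto
    finally show "dist (f y) (f z) \<le> norm a * dist y z"
      by (simp add: dist_norm mult.commute)
  qed
  ultimately have "\<exists>!y\<in>S. f y = y"
    using a(3) by (intro Banach_fix[of S "norm a"]) auto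
  then obtain y where y: "y \<in> S" "f y = y" by blast
  have "y + y = 2 *\<^sub>R f y"
    by (simp add: y(2) scaleR_2)
  also have "\<dots> = a + (y o\<^sub>L y)"
    by (simp add: f_def)
  finally show thesis
    using y(1) that by (auto simp: S_def)
qed

lemma star_automorphism_norm_le:
  assumes A: "cstar_algebra A" and one: "id_blinfun \<in> A"
    and \<alpha>: "star_automorphism A \<alpha>" "\<alpha> id_blinfun = id_blinfun"
    and x: "x \<in> A"
  shows "norm (\<alpha> x) \<le> norm x"
proof -
  note sp = operator_space_cstar_algebra[OF A]
  have cl: "clinear_op x" if "x \<in> A" for x
    using operator_spaceD(1)[OF sp that] .
  have \<alpha>A: "\<alpha> x \<in> A" if "x \<in> A" for x
    using \<alpha>(1) that by (auto simp: star_automorphism_def dest: bij_betwE)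
  have add: "\<alpha> (x + y) = \<alpha> x + \<alpha> y" and scale: "\<alpha> (scale_op c x) = scale_op c (\<alpha> x)"
    and mult: "\<alpha> (x o\<^sub>L y) = \<alpha> x o\<^sub>L \<alpha> y" and star: "\<alpha> (adj x) = adj (\<alpha> x)"
    if "x \<in> A" "y \<in> A" for x y c
    using \<alpha>(1) that by (auto simp: star_automorphism_def clinear_on_def)
  have diff: "\<alpha> (x - y) = \<alpha> x - \<alpha> y" if "x \<in> A" "y \<in> A" for x y
    using additive_on_simps(2)[of A \<alpha>, OF sp] add that by blast
  have unit: "norm (\<alpha> x) \<le> 1" if x: "x \<in> A" and "norm x < 1" for x
  proof -
    let ?a = "adj x o\<^sub>L x"
    have "norm ?a \<le> norm (adj x) * norm x"
      by (rule norm_blinfun_compose)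
    also have "\<dots> \<le> norm x * norm x"
      by (intro mult_right_mono norm_adj_le cl x) auto
    also have "\<dots> < 1"
      using \<open>norm x < 1\<close> mult_strict_mono'[of "norm x" 1 "norm x" 1] by simp
    finally have "norm ?a < 1" .
    moreover have aA: "?a \<in> A" and axA: "adj x \<in> A"
      using cstar_algebraD[OF A] x by blast+
    moreover have "adj ?a = ?a"
      using x axA by (simp add: adj_compose adj_adj cl)
    ultimately obtain y where y: "y \<in> A" "adj y = y" "y + y = ?a + (y o\<^sub>L y)"
      using self_adjoint_fixed_point[OF A] by blast
    let ?w = "id_blinfun - y"
    have wA: "?w \<in> A"
      by (intro operator_space_diff sp one y)
    have adj1: "adj id_blinfun = (id_blinfun :: 'a operator)"
      by (rule adj_eqI) simp
    \<comment> \<open>Here \<open>?w + y\<close> is the identity, so additivity of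
      \<open>adj\<close> yields self-adjointness of \<open>?w\<close>.\<close>
    have "adj (?w + y) = adj ?w + adj y"
      by (rule adj_add) (auto intro: cl wA y)
    then have adjw: "adj ?w = ?w"
      by (simp add: adj1 y(2) algebra_simps)
    have "?w o\<^sub>L ?w = id_blinfun - (y + y) + (y o\<^sub>L y)"
      by (rule blinfun_eqI) (simp add: blinfun.bilinear_simps)
    then have "?w o\<^sub>L ?w = id_blinfun - ?a"
      by (simp add: y(3))
    then have "\<alpha> ?w o\<^sub>L \<alpha> ?w = id_blinfun - (adj (\<alpha> x) o\<^sub>L \<alpha> x)"
      using mult[OF wA wA] diff[OF one aA] mult[OF axA x] star[OF x x] \<alpha>(2) by simp
    moreover have "adj (\<alpha> ?w) = \<alpha> ?w"
      using star[OF wA wA] adjw by simp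
    ultimately have eq: "adj (\<alpha> ?w) o\<^sub>L \<alpha> ?w = id_blinfun - (adj (\<alpha> x) o\<^sub>L \<alpha> x)"
      by simp
    have star_sq: "cinner \<xi> (blinfun_apply (adj z o\<^sub>L z) \<xi>)
        = complex_of_real ((norm (blinfun_apply z \<xi>))\<^sup>2)" if "z \<in> A" for z \<xi>
      using cinner_adj_right[OF cl[OF that]] by (simp add: cinner_self)
    show ?thesis
    proof (rule norm_blinfun_bound)
      fix \<xi>
      have "complex_of_real ((norm (blinfun_apply (\<alpha> ?w) \<xi>))\<^sup>2)
          = cinner \<xi> (\<xi> - blinfun_apply (adj (\<alpha> x) o\<^sub>L \<alpha> x) \<xi>)"
        unfolding star_sq[OF \<alpha>A[OF wA], symmetric] eq by (simp add: blinfun.diff_left)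
      also have "\<dots> = complex_of_real ((norm \<xi>)\<^sup>2 - (norm (blinfun_apply (\<alpha> x) \<xi>))\<^sup>2)"
        unfolding cinner.diff_right star_sq[OF \<alpha>A[OF x]] cinner_self by simp
      finally have "(norm (blinfun_apply (\<alpha> x) \<xi>))\<^sup>2 \<le> (norm \<xi>)\<^sup>2"
        unfolding of_real_eq_iff by (metis diff_ge_0_iff_ge zero_le_power2)
      then show "norm (blinfun_apply (\<alpha> x) \<xi>) \<le> 1 * norm \<xi>"
        using power2_le_imp_le by auto
    qed simp
  qed
  show ?thesis
  proof (rule dense_ge)
    \<comment> \<open>Dividing by t above \<open>norm x\<close>, instead of by
      \<open>norm x\<close>, gives the strict inequality that \<open>unit\<close> requires and also
      covers x = 0.\<close>
    fix t assume t: "norm x < t"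
    then have "0 < t"
      using norm_ge_zero[of x] by linarith
    have "\<alpha> ((1/t) *\<^sub>R x) = (1/t) *\<^sub>R \<alpha> x"
      using scale[OF x x] by (simp add: scale_op_of_real[symmetric])
    moreover have "norm (\<alpha> ((1/t) *\<^sub>R x)) \<le> 1"
      using t \<open>0 < t\<close> by (intro unit operator_space_scaleR sp x) simp
    ultimately show "norm (\<alpha> x) \<le> t"
      using \<open>0 < t\<close> by (simp add: field_simps)
  qed
qed

section \<open>Rapid decay along orbits\<close>

text \<open>On a sphere of radius r the weight is the constant (1 + r) powr (2 * s), which moves
  into D. The constant D depends on r, but not on the finite set or the coefficients.\<close>

lemma rapid_decay_const_length:
  fixes L :: "'g::group_add \<Rightarrow> real"
  assumes "rapid_decay L" "0 \<le> r"
  obtains D where "0 \<le> D"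
    "\<And>F f. finite F \<Longrightarrow> (\<And>g. g \<in> F \<Longrightarrow> L g = r) \<Longrightarrow>
      norm (\<Sum>g\<in>F. scale_op (f g) (left_regular g)) \<le> D * sqrt (\<Sum>g\<in>F. (cmod (f g))\<^sup>2)"
proof -
  obtain C s where "C > 0" and C: "\<And>f. finite {g. f g \<noteq> 0} \<Longrightarrow>
      norm (\<Sum>g | f g \<noteq> 0. scale_op (f g) (left_regular g))
        \<le> C * sqrt (\<Sum>g | f g \<noteq> 0. (cmod (f g))\<^sup>2 * (1 + L g) powr (2 * s))"
    using assms(1) unfolding rapid_decay_def by blast
  define K where "K = (1 + r) powr (2 * s)"
  have zero: "scale_op 0 x = 0" for x :: "'a operator"
    using scale_op_of_real[of 0 x] by simp
  show thesis
  proof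
    show "0 \<le> C * sqrt K" using \<open>C > 0\<close> by (simp add: K_def)
    fix F and f :: "'g \<Rightarrow> complex"
    assume F: "finite F" "\<And>g. g \<in> F \<Longrightarrow> L g = r"
    \<comment> \<open>\<open>rapid_decay\<close> sums over the exact support of a function on the
      whole group, so f is cut off outside F; points of F where f vanishes contribute
      nothing.\<close>
    define h where "h g = (if g \<in> F then f g else 0)" for g
    have sub: "{g. h g \<noteq> 0} \<subseteq> F"
      by (auto simp: h_def)
    have "(\<Sum>g\<in>F. scale_op (f g) (left_regular g)) = (\<Sum>g | h g \<noteq> 0. scale_op (h g) (left_regular g))"
      by (rule sum.mono_neutral_cong_right) (use F(1) sub in \<open>auto simp: h_def zero\<close>)
    also have "norm \<dots> \<le> C * sqrt (\<Sum>g | h g \<noteq> 0. (cmod (h g))\<^sup>2 * (1 + L g) powr (2 * s))"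
      by (rule C) (rule finite_subset[OF sub F(1)])
    also have "(\<Sum>g | h g \<noteq> 0. (cmod (h g))\<^sup>2 * (1 + L g) powr (2 * s))
        = (\<Sum>g\<in>F. (cmod (f g))\<^sup>2 * K)"
      by (rule sum.mono_neutral_cong_left) (use F sub in \<open>auto simp: h_def K_def\<close>)
    also have "\<dots> = (\<Sum>g\<in>F. (cmod (f g))\<^sup>2) * K"
      by (simp add: sum_distrib_right)
    finally show "norm (\<Sum>g\<in>F. scale_op (f g) (left_regular g))
        \<le> C * sqrt K * sqrt (\<Sum>g\<in>F. (cmod (f g))\<^sup>2)"
      by (simp add: real_sqrt_mult mult_ac)
  qed
qed

lemma rapid_decay_sequence:
  fixes \<gamma> :: "nat \<Rightarrow> 'g::group_add"
  assumes "rapid_decay L" "0 \<le> r" "inj \<gamma>" "\<And>n. L (\<gamma> n) = r"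
  obtains D where "0 \<le> D"
    "\<And>I c. finite I \<Longrightarrow>
      norm (\<Sum>k\<in>I. scale_op (c k) (left_regular (\<gamma> k))) \<le> D * sqrt (\<Sum>k\<in>I. (cmod (c k))\<^sup>2)"
proof -
  obtain D where "0 \<le> D" and D: "\<And>F f. finite F \<Longrightarrow> (\<And>g. g \<in> F \<Longrightarrow> L g = r) \<Longrightarrow>
      norm (\<Sum>g\<in>F. scale_op (f g) (left_regular g)) \<le> D * sqrt (\<Sum>g\<in>F. (cmod (f g))\<^sup>2)"
    using rapid_decay_const_length[OF assms(1,2)] by blast
  show thesis
  proof
    fix I :: "nat set" and c :: "nat \<Rightarrow> complex"
    assume "finite I"
    \<comment> \<open>Injectivity of \<gamma> allows coefficients indexed by k to be read as
      coefficients on group elements, with no two terms merging.\<close>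
    then have "norm (\<Sum>g\<in>\<gamma> ` I. scale_op (c (inv \<gamma> g)) (left_regular g))
        \<le> D * sqrt (\<Sum>g\<in>\<gamma> ` I. (cmod (c (inv \<gamma> g)))\<^sup>2)"
      by (intro D) (auto simp: assms(4))
    moreover have "inj_on \<gamma> I"
      using assms(3) by (rule inj_on_subset) simp
    ultimately show "norm (\<Sum>k\<in>I. scale_op (c k) (left_regular (\<gamma> k)))
        \<le> D * sqrt (\<Sum>k\<in>I. (cmod (c k))\<^sup>2)"
      by (simp add: sum.reindex inv_f_f[OF assms(3)])
  qed (rule \<open>0 \<le> D\<close>)
qed

text \<open>A single coincidence among forward iterates makes g periodic, because powers of \<beta>
  are injective, and then both the forward and the backward half of the orbit are finite.\<close>

lemma inj_funpow_of_infinite_orbit: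
  assumes "bij \<beta>" "infinite (aut_orbit \<beta> g)"
  shows "inj (\<lambda>n::nat. (\<beta> ^^ n) g)"
proof (rule ccontr)
  assume "\<not> inj (\<lambda>n::nat. (\<beta> ^^ n) g)"
  then obtain i j :: nat where ij: "i < j" "(\<beta> ^^ i) g = (\<beta> ^^ j) g"
    unfolding inj_on_def by (metis linorder_neqE_nat)
  define p where "p = j - i"
  have "j = i + p" using ij by (simp add: p_def)
  then have "(\<beta> ^^ i) ((\<beta> ^^ p) g) = (\<beta> ^^ i) g"
    using ij(2) by (simp add: funpow_add)
  then have p: "(\<beta> ^^ p) g = g"
    using bij_fn[OF assms(1)] by (meson bij_is_inj injD)
  \<comment> \<open>Stated for a general map, because it is applied to \<beta> and to its
    inverse.\<close>
  have fin: "finite (range (\<lambda>n::nat. (f ^^ n) g))" if "(f ^^ p) g = g" for f :: "'a \<Rightarrow> 'a"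
  proof (rule finite_subset)
    show "range (\<lambda>n::nat. (f ^^ n) g) \<subseteq> (\<lambda>n. (f ^^ n) g) ` {..<p}"
    proof safe
      fix n
      have "n mod p < p" using ij(1) by (simp add: p_def)
      then show "(f ^^ n) g \<in> (\<lambda>n. (f ^^ n) g) ` {..<p}"
        using funpow_mod_eq[OF that, of n] by (metis imageI lessThan_iff)
    qed
  qed simp
  have "(inv \<beta> ^^ p) g = g"
    using p inv_fn[OF assms(1), of p] bij_fn[OF assms(1), of p] by (metis bij_is_inj inv_f_eq)
  then show False
    using assms(2) fin p by (simp add: aut_orbit_def)
qed

lemma fixed_of_singleton_orbit:
  assumes "is_singleton (aut_orbit \<beta> g)"
  shows "\<beta> g = g"
proof -
  have "(\<beta> ^^ 0) g \<in> aut_orbit \<beta> g" "(\<beta> ^^ 1) g \<in> aut_orbit \<beta> g"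
    unfolding aut_orbit_def by (blast intro: rangeI)+
  with assms show ?thesis
    by (auto simp: is_singleton_def)
qed

section \<open>Averages and mixing\<close>

lemma state_norm_le:
  assumes "operator_space A" "state A \<phi>" "x \<in> A"
  shows "cmod (\<phi> x) \<le> norm x"
proof (cases "x = 0")
  case True
  have "\<phi> (scale_op 0 x) = 0 * \<phi> x"
    using assms by (auto simp: state_def clinear_on_def)
  moreover have "scale_op 0 x = x"
    using scale_op_of_real[of 0 x] True by simp
  ultimately show ?thesis by simp
next
  case False
  let ?y = "scale_op (complex_of_real (1 / norm x)) x"
  have "?y \<in> {x \<in> A. norm x \<le> 1}"
    using False operator_space_scaleR[OF assms(1,3)] unfolding scale_op_of_real by simp
  then have "cmod (\<phi> ?y) \<le> 1"
    using assms(2) cSUP_upper[of ?y "{x \<in> A. norm x \<le> 1}" "\<lambda>x. cmod (\<phi> x)"]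
    by (simp add: state_def norm_one_on_def)
  moreover have "\<phi> ?y = complex_of_real (1 / norm x) * \<phi> x"
    using assms by (auto simp: state_def clinear_on_def)
  ultimately have "cmod (\<phi> x) / norm x \<le> 1"
    by (simp only: norm_mult norm_of_real) simp
  then show ?thesis
    using False by (simp add: divide_le_eq)
qed

locale rapid_decay_automorphism =
  fixes L :: "'g::group_add \<Rightarrow> real"
    and \<beta> :: "'g \<Rightarrow> 'g"
    and \<alpha> :: "'g operator \<Rightarrow> 'g operator"
  assumes length: "length_function L"
    and rapid_decay: "rapid_decay L"
    and automorphism: "group_automorphism \<beta>"
    and length_preserving: "\<And>g. L (\<beta> g) = L g"
    and orbits: "\<And>g. infinite (aut_orbit \<beta> g) \<or> is_singleton (aut_orbit \<beta> g)"
    and star_automorphism: "star_automorphism reduced_cstar_algebra \<alpha>"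
    and alpha_left_regular: "\<And>g. \<alpha> (left_regular g) = left_regular (\<beta> g)"
begin

abbreviation A :: "'g operator set" where "A \<equiv> reduced_cstar_algebra"
abbreviation E :: "'g operator \<Rightarrow> 'g operator" where "E \<equiv> ergodic_limit \<alpha>"
abbreviation fixed_points :: "'g operator set" where "fixed_points \<equiv> fixed_subalgebra A \<alpha>"

lemma space_A: "operator_space A"
  by (rule operator_space_cstar_algebra[OF cstar_algebra_reduced])

lemma id_in_A: "id_blinfun \<in> A"
  using left_regular_in_reduced[of 0] by (simp add: left_regular_0)

lemma alpha_id: "\<alpha> id_blinfun = id_blinfun"
proof -
  have "\<beta> (0 + 0) = \<beta> 0 + \<beta> 0"
    using automorphism unfolding group_automorphism_def by blast
  then have "\<beta> 0 = 0"
    by (metis add_left_imp_eq add_0_right)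
  then show ?thesis
    using alpha_left_regular[of 0] by (simp add: left_regular_0)
qed

lemma alpha_in_A: "x \<in> A \<Longrightarrow> \<alpha> x \<in> A"
  using star_automorphism by (auto simp: star_automorphism_def dest: bij_betwE)

lemma alpha_simps:
  assumes "x \<in> A"
  shows "y \<in> A \<Longrightarrow> \<alpha> (x + y) = \<alpha> x + \<alpha> y" "\<alpha> (scale_op c x) = scale_op c (\<alpha> x)"
    "y \<in> A \<Longrightarrow> \<alpha> (x o\<^sub>L y) = \<alpha> x o\<^sub>L \<alpha> y" "\<alpha> (adj x) = adj (\<alpha> x)"
  using star_automorphism assms by (auto simp: star_automorphism_def clinear_on_def)

lemma norm_alpha_le: "x \<in> A \<Longrightarrow> norm (\<alpha> x) \<le> norm x"
  by (rule star_automorphism_norm_le[OF cstar_algebra_reduced id_in_A star_automorphism alpha_id])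

lemma power_in_A: "x \<in> A \<Longrightarrow> (\<alpha> ^^ n) x \<in> A"
  by (induction n) (auto intro: alpha_in_A)

lemma power_add: "x \<in> A \<Longrightarrow> y \<in> A \<Longrightarrow> (\<alpha> ^^ n) (x + y) = (\<alpha> ^^ n) x + (\<alpha> ^^ n) y"
  by (induction n) (auto simp: alpha_simps power_in_A)

lemma power_scale: "x \<in> A \<Longrightarrow> (\<alpha> ^^ n) (scale_op c x) = scale_op c ((\<alpha> ^^ n) x)"
  by (induction n) (auto simp: alpha_simps power_in_A)

lemma norm_power_le: "x \<in> A \<Longrightarrow> norm ((\<alpha> ^^ n) x) \<le> norm x"
  by (induction n) (auto intro: order_trans[OF norm_alpha_le] power_in_A)

lemma power_left_regular: "(\<alpha> ^^ n) (left_regular g) = left_regular ((\<beta> ^^ n) g)"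
  by (induction n) (auto simp: alpha_left_regular)

lemma power_fixed: "\<alpha> x = x \<Longrightarrow> (\<alpha> ^^ n) x = x"
  by (induction n) auto

section \<open>Convergence of the ergodic averages\<close>

lemma average_in_A: "x \<in> A \<Longrightarrow> ergodic_average \<alpha> n x \<in> A"
  unfolding ergodic_average_def
  by (intro operator_space_scaleR operator_space_sum space_A power_in_A)

lemma average_add:
  "x \<in> A \<Longrightarrow> y \<in> A \<Longrightarrow> ergodic_average \<alpha> n (x + y) = ergodic_average \<alpha> n x + ergodic_average \<alpha> n y"
  by (simp add: ergodic_average_def power_add sum.distrib scaleR_add_right)

lemma average_scale:
  "x \<in> A \<Longrightarrow> ergodic_average \<alpha> n (scale_op c x) = scale_op c (ergodic_average \<alpha> n x)"
  unfolding ergodic_average_def scale_op_of_real[symmetric]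
  by (simp add: power_scale scale_op_scale_op mult.commute flip: scale_op_sum)

lemma norm_average_le:
  assumes "x \<in> A"
  shows "norm (ergodic_average \<alpha> n x) \<le> norm x"
proof (cases "n = 0")
  case False
  have "norm (\<Sum>k=1..n. (\<alpha> ^^ k) x) \<le> of_nat (card {1..n}) * norm x"
    by (rule sum_norm_bound) (rule norm_power_le[OF assms])
  then show ?thesis
    using False by (simp add: ergodic_average_def field_simps)
qed (simp add: ergodic_average_def)

text \<open>The index 0 is excluded because the average over the empty range is 0.\<close>

lemma average_fixed: "\<alpha> x = x \<Longrightarrow> 0 < n \<Longrightarrow> ergodic_average \<alpha> n x = x"
  by (simp add: ergodic_average_def power_fixed sum_constant_scaleR)

lemma average_fixed_tendsto: "\<alpha> x = x \<Longrightarrow> (\<lambda>n. ergodic_average \<alpha> n x) \<longlonglongrightarrow> x"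
  by (rule tendsto_eventually) (auto simp: eventually_sequentially average_fixed intro!: exI[of _ 1])

lemma rapid_decay_infinite_orbit:
  assumes "infinite (aut_orbit \<beta> g)"
  obtains D where "0 \<le> D"
    "\<And>I c. finite I \<Longrightarrow>
      norm (\<Sum>k\<in>I. scale_op (c k) ((\<alpha> ^^ k) (left_regular g))) \<le> D * sqrt (\<Sum>k\<in>I. (cmod (c k))\<^sup>2)"
proof -
  have "bij \<beta>"
    using automorphism by (simp add: group_automorphism_def)
  then have "inj (\<lambda>n::nat. (\<beta> ^^ n) g)"
    using assms by (rule inj_funpow_of_infinite_orbit)
  moreover have "L ((\<beta> ^^ n) g) = L g" for n
    by (induction n) (auto simp: length_preserving)
  moreover have "0 \<le> L g"
    using length by (simp add: length_function_def)
  ultimately show thesis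
    using rapid_decay_sequence[OF rapid_decay, of "L g" "\<lambda>n. (\<beta> ^^ n) g"] that
    by (auto simp: power_left_regular)
qed

lemma average_infinite_orbit:
  assumes "infinite (aut_orbit \<beta> g)"
  shows "(\<lambda>n. ergodic_average \<alpha> n (left_regular g)) \<longlonglongrightarrow> 0"
proof -
  obtain D where D: "\<And>I c. finite I \<Longrightarrow>
      norm (\<Sum>k\<in>I. scale_op (c k) ((\<alpha> ^^ k) (left_regular g))) \<le> D * sqrt (\<Sum>k\<in>I. (cmod (c k))\<^sup>2)"
    using rapid_decay_infinite_orbit[OF assms] by blast
  \<comment> \<open>Valid for n = 0 too: both sides are 0, by \<open>1 / 0 = 0\<close>.\<close>
  have "norm (ergodic_average \<alpha> n (left_regular g)) \<le> D * sqrt (1 / real n)" for n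
  proof -
    have "ergodic_average \<alpha> n (left_regular g)
        = (\<Sum>k=1..n. scale_op (complex_of_real (1 / real n)) ((\<alpha> ^^ k) (left_regular g)))"
      unfolding ergodic_average_def scale_op_of_real by (rule scaleR_sum_right)
    also have "norm \<dots> \<le> D * sqrt (\<Sum>k=1..n. (cmod (complex_of_real (1 / real n)))\<^sup>2)"
      by (rule D) simp
    also have "(\<Sum>k=1..n. (cmod (complex_of_real (1 / real n)))\<^sup>2) = 1 / real n"
      by (simp add: norm_divide power2_eq_square)
    finally show ?thesis .
  qed
  moreover have "(\<lambda>n. sqrt (1 / real n)) \<longlonglongrightarrow> 0"
    using tendsto_real_sqrt[OF lim_1_over_n] by simp
  then have "(\<lambda>n. D * sqrt (1 / real n)) \<longlonglongrightarrow> 0"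
    by (rule tendsto_mult_right_zero)
  ultimately show ?thesis
    by (blast intro: Lim_null_comparison[OF eventuallyI, rotated])
qed

lemma left_regular_cases:
  obtains (fixed) "\<alpha> (left_regular g) = left_regular g"
  | (infinite) "infinite (aut_orbit \<beta> g)"
  using orbits[of g] fixed_of_singleton_orbit[of \<beta> g] alpha_left_regular[of g] by auto

text \<open>The Cauchy property is phrased as a null limit over pairs of indices. In this form it is
  linear in x with the uniform bound 2, one for each average, so it defines an operator space and
  needs checking only on the group unitaries.\<close>

lemma average_tendsto:
  assumes "x \<in> A"
  shows "(\<lambda>n. ergodic_average \<alpha> n x) \<longlonglongrightarrow> E x"
proof -
  let ?d = "\<lambda>i x. ergodic_average \<alpha> (fst i) x - ergodic_average \<alpha> (snd i) x"
  have lim: "((\<lambda>i. ?d i x) \<longlongrightarrow> 0) (sequentially \<times>\<^sub>F sequentially)"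
  proof (rule reduced_cstar_algebra_induct[OF assms])
    show "operator_space {x \<in> A. ((\<lambda>i. ?d i x) \<longlongrightarrow> 0) (sequentially \<times>\<^sub>F sequentially)}"
    proof (rule operator_space_tendsto_zero[OF space_A, where K = 2])
      fix i :: "nat \<times> nat" and x y assume "x \<in> A" "y \<in> A"
      then show "?d i (x + y) = ?d i x + ?d i y"
        by (simp add: average_add)
    next
      fix i :: "nat \<times> nat" and c x assume "x \<in> A"
      then show "norm (?d i (scale_op c x)) \<le> cmod c * norm (?d i x)"
        by (simp add: average_scale scale_op_diff[symmetric] norm_scale_op_le)
    next
      fix i :: "nat \<times> nat" and x assume x: "x \<in> A"
      show "norm (?d i x) \<le> 2 * norm x"
        using norm_triangle_ineq4[of "ergodic_average \<alpha> (fst i) x" "ergodic_average \<alpha> (snd i) x"]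
          norm_average_le[OF x, of "fst i"] norm_average_le[OF x, of "snd i"] by simp
    qed
    fix g
    obtain l where l: "(\<lambda>n. ergodic_average \<alpha> n (left_regular g)) \<longlonglongrightarrow> l"
      using average_fixed_tendsto average_infinite_orbit by (metis left_regular_cases)
    have "((\<lambda>i. ?d i (left_regular g)) \<longlongrightarrow> l - l) (sequentially \<times>\<^sub>F sequentially)"
      by (intro tendsto_diff filterlim_compose[OF l] filterlim_fst filterlim_snd)
    then show "((\<lambda>i. ?d i (left_regular g)) \<longlongrightarrow> 0) (sequentially \<times>\<^sub>F sequentially)"
      by simp
  qed
  have "Cauchy (\<lambda>n. ergodic_average \<alpha> n x)"
  proof (rule metric_CauchyI)
    fix e :: real assume "0 < e"
    from tendstoD[OF lim this]
    show "\<exists>M. \<forall>m\<ge>M. \<forall>n\<ge>M. dist (ergodic_average \<alpha> m x) (ergodic_average \<alpha> n x) < e"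
      unfolding eventually_prod_sequentially by (auto simp: dist_norm norm_minus_commute)
  qed
  then show ?thesis
    unfolding ergodic_limit_def by (simp add: Cauchy_convergent_iff convergent_LIMSEQ_iff)
qed

section \<open>The limit as a conditional expectation\<close>

lemma E_eqI: "x \<in> A \<Longrightarrow> (\<lambda>n. ergodic_average \<alpha> n x) \<longlonglongrightarrow> y \<Longrightarrow> E x = y"
  using average_tendsto LIMSEQ_unique by blast

lemma E_fixed: "x \<in> A \<Longrightarrow> \<alpha> x = x \<Longrightarrow> E x = x"
  by (rule E_eqI) (auto intro: average_fixed_tendsto)

lemma E_in_A: "x \<in> A \<Longrightarrow> E x \<in> A"
  using closed_sequentially[OF operator_spaceD(5)[OF space_A] _ average_tendsto] average_in_A
  by blast

lemma E_add: "x \<in> A \<Longrightarrow> y \<in> A \<Longrightarrow> E (x + y) = E x + E y"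
  by (rule E_eqI) (auto simp: average_add intro!: tendsto_add average_tendsto operator_spaceD(3)[OF space_A])

lemma E_scale:
  assumes "x \<in> A"
  shows "E (scale_op c x) = scale_op c (E x)"
proof (rule E_eqI)
  show "(\<lambda>n. ergodic_average \<alpha> n (scale_op c x)) \<longlonglongrightarrow> scale_op c (E x)"
    unfolding average_scale[OF assms] unfolding scale_op_def
    by (intro bounded_bilinear.tendsto[OF bounded_bilinear_blinfun_compose] tendsto_const
        average_tendsto assms)
qed (rule operator_spaceD(4)[OF space_A assms])

lemma norm_E_le: "x \<in> A \<Longrightarrow> norm (E x) \<le> norm x"
  by (rule LIMSEQ_le_const2[OF tendsto_norm[OF average_tendsto]]) (auto intro: norm_average_le)

text \<open>Applying \<alpha> to an average shifts its summation range by one, which changes the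
  average by at most 2 \<open>norm x\<close> / n.\<close>

lemma alpha_E:
  assumes "x \<in> A"
  shows "\<alpha> (E x) = E x"
proof -
  have lim: "(\<lambda>n. \<alpha> (ergodic_average \<alpha> n x)) \<longlonglongrightarrow> \<alpha> (E x)"
    by (rule additive_on_tendsto[OF space_A, where f = \<alpha> and K = 1])
      (auto simp: alpha_simps norm_alpha_le assms intro: average_tendsto average_in_A E_in_A)
  have "(\<lambda>n. \<alpha> (ergodic_average \<alpha> n x) - ergodic_average \<alpha> n x) \<longlonglongrightarrow> 0"
  proof (rule Lim_null_comparison[OF eventuallyI])
    fix n
    have "\<alpha> (\<Sum>k=1..n. (\<alpha> ^^ k) x) = (\<Sum>k=1..n. \<alpha> ((\<alpha> ^^ k) x))"
      by (rule additive_on_simps(3)[OF space_A]) (auto intro: alpha_simps(1) power_in_A assms)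
    then have "\<alpha> (ergodic_average \<alpha> n x) = (1 / real n) *\<^sub>R (\<Sum>k=1..n. (\<alpha> ^^ Suc k) x)"
      unfolding ergodic_average_def scale_op_of_real[symmetric]
      by (simp add: alpha_simps(2) operator_space_sum[OF space_A] power_in_A assms)
    \<comment> \<open>Telescoping leaves only the two end terms.\<close>
    moreover have "(\<Sum>k=1..n. (\<alpha> ^^ Suc k) x) - (\<Sum>k=1..n. (\<alpha> ^^ k) x) = (\<alpha> ^^ Suc n) x - \<alpha> x"
      unfolding sum_subtractf[symmetric]
      by (induction n) (auto simp: algebra_simps)
    ultimately have "\<alpha> (ergodic_average \<alpha> n x) - ergodic_average \<alpha> n x
        = (1 / real n) *\<^sub>R ((\<alpha> ^^ Suc n) x - \<alpha> x)"
      by (simp add: ergodic_average_def scaleR_diff_right[symmetric])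
    also have "norm \<dots> \<le> (1 / real n) * (norm x + norm x)"
      unfolding norm_scaleR
      using norm_triangle_ineq4[of "(\<alpha> ^^ Suc n) x" "\<alpha> x"] norm_power_le[OF assms, of "Suc n"]
        norm_alpha_le[OF assms]
      by (intro mult_mono) auto
    finally show "norm (\<alpha> (ergodic_average \<alpha> n x) - ergodic_average \<alpha> n x)
        \<le> (1 / real n) * (norm x + norm x)" .
  next
    show "(\<lambda>n. (1 / real n) * (norm x + norm x)) \<longlonglongrightarrow> 0"
      by (rule tendsto_mult_left_zero[OF lim_1_over_n])
  qed
  from tendsto_diff[OF lim this] have "(\<lambda>n. ergodic_average \<alpha> n x) \<longlonglongrightarrow> \<alpha> (E x)"
    by simp
  then show ?thesis
    by (rule E_eqI[OF assms, symmetric])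
qed

lemma cstar_algebra_fixed_points: "cstar_algebra fixed_points"
proof -
  \<comment> \<open>Fixed points are the kernel of \<alpha> - id, a bounded map on the algebra, so
    closedness comes with the preimage lemma.\<close>
  have "operator_space {x \<in> A. \<alpha> x - x \<in> {0}}"
  proof (rule operator_space_vimage[OF space_A, where K = 2 and \<sigma> = "\<lambda>c. c"])
    show "operator_space {0 :: 'g operator}"
      by (simp add: operator_space_def clinear_op_intros scale_op_zero)
    show "norm (\<alpha> x - x) \<le> 2 * norm x" if "x \<in> A" for x
      using norm_triangle_ineq4[of "\<alpha> x" x] norm_alpha_le[OF that] by simp
    show "\<alpha> (scale_op c x) - scale_op c x = scale_op c (\<alpha> x - x)" if "x \<in> A" for c x
      by (simp add: alpha_simps(2) that scale_op_diff)
  qed (simp add: alpha_simps)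
  then have "operator_space fixed_points"
    by (simp add: fixed_subalgebra_def)
  then show ?thesis
    using cstar_algebraD[OF cstar_algebra_reduced]
    by (auto simp: operator_space_def cstar_algebra_def fixed_subalgebra_def alpha_simps)
qed

lemma conditional_expectation_E: "conditional_expectation A fixed_points E"
proof -
  have "norm_one_on A E"
    unfolding norm_one_on_def
  proof
    show "bdd_above ((\<lambda>x. norm (E x)) ` {x \<in> A. norm x \<le> 1})"
      by (auto intro!: bdd_aboveI2[where M = 1] order_trans[OF norm_E_le])
    \<comment> \<open>The identity has norm 1 only on a nonzero space; a basis vector at any group
      element shows this. The supremum is then attained at the identity, which E fixes.\<close>
    have "basis_ell2 undefined \<noteq> (0 :: 'g ell2)"
      by (metis ell2_apply_basis ell2_apply_simps(5) zero_neq_one)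
    then have "norm (id_blinfun :: 'g operator) = 1"
      using norm_blinfun[of "id_blinfun :: 'g operator" "basis_ell2 undefined"]
        norm_blinfun_id_le[where 'a = "'g ell2"] by simp
    then have "id_blinfun \<in> {x \<in> A. norm x \<le> 1}" "norm (E id_blinfun) = 1"
      by (simp_all add: id_in_A E_fixed alpha_id)
    then show "(SUP x\<in>{x \<in> A. norm x \<le> 1}. norm (E x)) = 1"
      by (intro cSup_eq_maximum) (auto intro!: order_trans[OF norm_E_le] image_eqI[of 1])
  qed
  then show ?thesis
    using cstar_algebra_reduced cstar_algebra_fixed_points
    by (auto simp: conditional_expectation_def clinear_on_def fixed_subalgebra_def E_add E_scale
        E_in_A alpha_E E_fixed)
qed

section \<open>Mixing\<close>

text \<open>Testing \<open>\<phi>\<close> on \<open>\<Sum>n<N. cnj (z n) \<cdot> \<alpha>\<^sup>n (\<lambda>\<^sub>g)\<close>, where \<open>z n = \<phi> (\<alpha>\<^sup>n (\<lambda>\<^sub>g))\<close>, rapid decay makes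
  \<open>z\<close> square summable.\<close>

lemma state_infinite_orbit:
  assumes \<phi>: "state A \<phi>" and g: "infinite (aut_orbit \<beta> g)"
  shows "(\<lambda>n. \<phi> ((\<alpha> ^^ n) (left_regular g))) \<longlonglongrightarrow> 0"
proof -
  define z where "z n = \<phi> ((\<alpha> ^^ n) (left_regular g))" for n
  obtain D where "0 \<le> D" and D: "\<And>I c. finite I \<Longrightarrow>
      norm (\<Sum>k\<in>I. scale_op (c k) ((\<alpha> ^^ k) (left_regular g))) \<le> D * sqrt (\<Sum>k\<in>I. (cmod (c k))\<^sup>2)"
    using rapid_decay_infinite_orbit[OF g] by blast
  have \<phi>_lin: "\<phi> (x + y) = \<phi> x + \<phi> y" "\<phi> (scale_op c x) = c * \<phi> x" if "x \<in> A" "y \<in> A" for x y c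
    using \<phi> that by (auto simp: state_def clinear_on_def)
  have pA: "(\<alpha> ^^ k) (left_regular g) \<in> A" for k
    by (intro power_in_A left_regular_in_reduced)
  have "(\<Sum>n<N. (cmod (z n))\<^sup>2) \<le> D\<^sup>2" for N
  proof -
    define S where "S = (\<Sum>n<N. (cmod (z n))\<^sup>2)"
    let ?y = "\<Sum>n<N. scale_op (cnj (z n)) ((\<alpha> ^^ n) (left_regular g))"
    have yA: "?y \<in> A"
      by (intro operator_space_sum operator_spaceD(4) space_A pA)
    have "\<phi> ?y = (\<Sum>n<N. \<phi> (scale_op (cnj (z n)) ((\<alpha> ^^ n) (left_regular g))))"
      by (rule additive_on_simps(3)[OF space_A])
        (auto intro: \<phi>_lin operator_spaceD(4) space_A pA)
    also have "\<dots> = complex_of_real S"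
      using \<phi>_lin(2)[OF pA pA]
      by (simp add: S_def z_def[symmetric] complex_norm_square mult.commute del: of_real_power)
    finally have "\<bar>S\<bar> = cmod (\<phi> ?y)"
      by simp
    also have "\<dots> \<le> norm ?y"
      by (rule state_norm_le[OF space_A \<phi> yA])
    also have "\<dots> \<le> D * sqrt S"
      using D[of "{..<N}" "\<lambda>n. cnj (z n)"] by (simp add: S_def)
    finally have "S \<le> D * sqrt S"
      by simp
    moreover have "0 \<le> S"
      by (simp add: S_def sum_nonneg)
    \<comment> \<open>Cancelling one factor \<open>sqrt S\<close> bounds the partial sum
      independently of N; if S = 0 the bound is just \<open>0 \<le> D\<close>.\<close>
    ultimately have "sqrt S * sqrt S \<le> D * sqrt S"
      by simp
    then have "sqrt S \<le> D"
      using \<open>0 \<le> D\<close> \<open>0 \<le> S\<close> mult_right_le_imp_le[of "sqrt S" "sqrt S" D] by (cases "S = 0") auto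
    then show ?thesis
      using \<open>0 \<le> S\<close> by (simp add: S_def[symmetric] sqrt_le_D)
  qed
  then have "summable (\<lambda>n. (cmod (z n))\<^sup>2)"
    by (intro summableI_nonneg_bounded) auto
  then have "(\<lambda>n. sqrt ((cmod (z n))\<^sup>2)) \<longlonglongrightarrow> sqrt 0"
    by (intro tendsto_real_sqrt summable_LIMSEQ_zero)
  then have "z \<longlonglongrightarrow> 0"
    using tendsto_norm_zero_cancel by simp
  then show ?thesis
    by (simp add: z_def[abs_def])
qed

lemma mixing_E: "mixing_wrt A E \<alpha>"
  unfolding mixing_wrt_def
proof (intro ballI allI impI)
  fix x \<phi> assume x: "x \<in> A" and \<phi>: "state A \<phi>"
  have \<phi>_lin: "\<phi> (x + y) = \<phi> x + \<phi> y" "\<phi> (scale_op c x) = c * \<phi> x" if "x \<in> A" "y \<in> A" for x y c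
    using \<phi> that by (auto simp: state_def clinear_on_def)
  \<comment> \<open>Subtracting the expected limit gives a null sequence linear in x. The bound 2
    comes from contractivity of \<phi>, of the powers of \<alpha> and of E.\<close>
  let ?f = "\<lambda>n x. \<phi> ((\<alpha> ^^ n) x) - \<phi> (E x)"
  have "(\<lambda>n. ?f n x) \<longlonglongrightarrow> 0"
  proof (rule reduced_cstar_algebra_induct[OF x])
    show "operator_space {x \<in> A. (\<lambda>n. ?f n x) \<longlonglongrightarrow> 0}"
    proof (rule operator_space_tendsto_zero[OF space_A, where K = 2])
      fix n and x y assume xy: "x \<in> A" "y \<in> A"
      then show "?f n (x + y) = ?f n x + ?f n y"
        by (simp add: power_add E_add \<phi>_lin power_in_A E_in_A)
    next
      fix n c and x assume x: "x \<in> A"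
      have "?f n (scale_op c x) = c * ?f n x"
        using \<phi>_lin(2)[OF power_in_A[OF x] x] \<phi>_lin(2)[OF E_in_A[OF x] x]
        by (simp add: power_scale E_scale x algebra_simps)
      then show "cmod (?f n (scale_op c x)) \<le> cmod c * cmod (?f n x)"
        by (simp add: norm_mult)
    next
      fix n and x assume x: "x \<in> A"
      show "cmod (?f n x) \<le> 2 * norm x"
        using norm_triangle_ineq4[of "\<phi> ((\<alpha> ^^ n) x)" "\<phi> (E x)"]
          state_norm_le[OF space_A \<phi> power_in_A[OF x], of n] norm_power_le[OF x, of n]
          state_norm_le[OF space_A \<phi> E_in_A[OF x]] norm_E_le[OF x]
        by linarith
    qed
    fix g
    show "(\<lambda>n. ?f n (left_regular g)) \<longlonglongrightarrow> 0"
    proof (cases rule: left_regular_cases[of g])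
      case fixed
      then show ?thesis
        by (simp add: power_fixed E_fixed left_regular_in_reduced)
    next
      case infinite
      have "E (left_regular g) = 0"
        by (rule E_eqI[OF left_regular_in_reduced average_infinite_orbit[OF infinite]])
      moreover have "\<phi> 0 = 0"
        by (rule additive_on_simps(1)[OF space_A]) (rule \<phi>_lin)
      ultimately show ?thesis
        using state_infinite_orbit[OF \<phi> infinite] by simp
    qed
  qed
  then show "(\<lambda>n. \<phi> ((\<alpha> ^^ n) x)) \<longlonglongrightarrow> \<phi> (E x)"
    by (simp add: Lim_null[symmetric])
qed

end

theorem theorem3p2:
  fixes L :: "'g::group_add \<Rightarrow> real"
    and \<beta> :: "'g \<Rightarrow> 'g"
    and \<alpha> :: "'g operator \<Rightarrow> 'g operator"
  assumes "length_function L"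
    and "rapid_decay L"
    and "group_automorphism \<beta>"
    and "\<And>g. L (\<beta> g) = L g"
    and "\<And>g. infinite (aut_orbit \<beta> g) \<or> is_singleton (aut_orbit \<beta> g)"
    and "star_automorphism reduced_cstar_algebra \<alpha>"
    and "\<And>g. \<alpha> (left_regular g) = left_regular (\<beta> g)"
  shows "(\<forall>x\<in>reduced_cstar_algebra.
            (\<lambda>n. ergodic_average \<alpha> n x) \<longlonglongrightarrow> ergodic_limit \<alpha> x) \<and>
         conditional_expectation reduced_cstar_algebra
            (fixed_subalgebra reduced_cstar_algebra \<alpha>) (ergodic_limit \<alpha>) \<and>
         mixing_wrt reduced_cstar_algebra (ergodic_limit \<alpha>) \<alpha>"
proof -
  interpret rapid_decay_automorphism L \<beta> \<alpha>
    using assms by unfold_locales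
  show ?thesis
    using average_tendsto conditional_expectation_E mixing_E by blast
qed

end
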